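(* Let $\mathbf y=(y_1,y_2,y_3)^T$ and $\mathbf P\mathbf y=(\mathbf Py_1,\mathbf Py_2,\mathbf Py_3)^T$, where $y_1,y_2,y_3$ satisfy the Kraichnan-Orszag three-mode system $$\frac{dy_1}{dt}=y_1y_3,\qquad \frac{dy_2}{dt}=-y_2y_3,\qquad \frac{dy_3}{dt}=-y_1^2+y_2^2,$$ with random initial conditions $y_i(0)=y_i(0;\omega)$, $i=1,2,3$. Let $\hat{\mathbf y}'=(\hat y_1',\hat y_2',\hat y_3')^T$, with each $\hat y_i'$ taking values in $\mathrm{span}\{\Phi_{\mathbf i}:\mathbf i\in F\}$, satisfy the $t$-model system $$\begin{aligned} \frac{d\hat y_1'}{dt} &= \mathbf P\mathbf B(\hat y_1',\hat y_3')+t\,\mathbf P\mathbf B(\Gamma_1,\hat y_3')+t\,\mathbf P\mathbf B(\hat y_1',\Gamma_3),\\ \frac{d\hat y_2'}{dt} &= -\mathbf P\mathbf B(\hat y_2',\hat y_3')-t\,\mathbf P\mathbf B(\Gamma_2,\hat y_3')-t\,\mathbf P\mathbf B(\hat y_2',\Gamma_3),\\ \frac{d\hat y_3'}{dt} &= -\mathbf P\mathbf B(\hat y_1',\hat y_1')+\mathbf P\mathbf B(\hat y_2',\hat y_2')-t\,\mathbf P\{\mathbf B(\Gamma_1,\hat y_1')+\mathbf B(\hat y_1',\Gamma_1)\}+t\,\mathbf P\{\mathbf B(\Gamma_2,\hat y_2')+\mathbf B(\hat y_2',\Gamma_2)\}, \end{aligned}$$ where $\Gamma_1=(\mathbf I-\mathbf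 P)\mathbf B(\hat y_1',\hat y_3')$, $\Gamma_2=-(\mathbf I-\mathbf P)\mathbf B(\hat y_2',\hat y_3')$ and $\Gamma_3=-(\mathbf I-\mathbf P)\mathbf B(\hat y_1',\hat y_1')+(\mathbf I-\mathbf P)\mathbf B(\hat y_2',\hat y_2')$. Then there exist constants $A$, $B$ and $C$ such that $$\begin{aligned} \frac12\frac{d}{dt}\|\hat{\mathbf y}'-\mathbf P\mathbf y\|^2\le{}&(A+tB)\|\hat{\mathbf y}'-\mathbf P\mathbf y\|^2+C\|(\mathbf I-\mathbf P)\mathbf y\|^2\\ &+5t\|(\mathbf I-\mathbf P)\mathbf B(\mathbf Py_1,\mathbf Py_3)\|^2+5t\|(\mathbf I-\mathbf P)\mathbf B(\mathbf Py_2,\mathbf Py_3)\|^2\\ &+t\|(\mathbf I-\mathbf P)\mathbf B(\mathbf Py_1,\mathbf Py_1)\|^2+t\|(\mathbf I-\mathbf P)\mathbf B(\mathbf Py_2,\mathbf Py_2)\|^2 . \end{aligned}$$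
   Context: Let $(\Omega,\mathcal A,\mathcal P)$ be a probability space and $\boldsymbol\xi=(\xi_1,\dots,\xi_d)$ a $d$-dimensional random vector on it. For multi-indices $\mathbf i=(i_1,\dots,i_d)\in\mathbb N_0^d$ with $|\mathbf i|=i_1+\cdots+i_d$, let $\{\Phi_{\mathbf i}\}$ be an orthonormal generalized polynomial chaos basis spanning the space of second-order random processes on this probability space: $\Phi_{\mathbf i}=\Phi_{\mathbf i}(\boldsymbol\xi)$ is a polynomial of degree $|\mathbf i|$ and $\int_\Omega\Phi_{\mathbf i}\Phi_{\mathbf j}\,d\mathcal P=\delta_{\mathbf i\mathbf j}$. The inner product on the random space is $(f,g)=\int_\Omega fg\,d\mathcal P$ and $\|\cdot\|$ is the corresponding $L_2(\Omega)$ norm; for a vector $\mathbf f=(f_1,f_2,f_3)^T$, $\|\mathbf f\|^2=\sum_{i=1}^3\|f_i\|^2$, and projections act componentwise. Fix $p_r\in\mathbb N_0$ and let $F=\{\mathbf i:0\le|\mathbf i|\le p_r\}$ be the set of indices of the resolved modes. $\mathbf P$ is the (orthogonal) projection onto the space spanned by $\{\Phi_{\mathbf i}:\mathbf i\in F\}$, $\mathbf I$ is the identity, and $\mathbf B(f,g)=fg$ is the product of two functions (the scalar constant $B$ in the claim is unrelated to $\mathbf B$). The $t$-model is a reduced model of the Kraichnan-Orszag system for the resolved modes, in which $t\ge 0$ is time; the theorem bounds the growth of the error between the $t$-model solution and the projection of the true solution.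
   Formalization: Added assumption: the products y_i(0)y_j(0)Φ_k are integrable for all i, j and all k in F (so P B(y_i,y_j) makes sense initially); for merely square-integrable initial data the derivative of the squared error may fail to exist at t=0 and the bound may fail. *)

theory Defs
  imports "HOL-Probability.Probability"
begin

section \<open>Second-order random variables\<close>

definition square_integrable :: "'a measure \<Rightarrow> ('a \<Rightarrow> real) \<Rightarrow> bool" where
  "square_integrable M f \<longleftrightarrow> f \<in> borel_measurable M \<and> integrable M (\<lambda>\<omega>. (f \<omega>)\<^sup>2)"

definition l2_inner :: "'a measure \<Rightarrow> ('a \<Rightarrow> real) \<Rightarrow> ('a \<Rightarrow> real) \<Rightarrow> real" where
  "l2_inner M f g = (LINT \<omega>|M. f \<omega> * g \<omega>)"

definition l2_norm :: "'a measure \<Rightarrow> ('a \<Rightarrow> real) \<Rightarrow> real" where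
  "l2_norm M f = sqrt (l2_inner M f f)"

definition l2_norm_vec :: "'a measure \<Rightarrow> (3 \<Rightarrow> 'a \<Rightarrow> real) \<Rightarrow> real" where
  "l2_norm_vec M f = L2_set (\<lambda>i. l2_norm M (f i)) UNIV"

definition prodB :: "('a \<Rightarrow> real) \<Rightarrow> ('a \<Rightarrow> real) \<Rightarrow> 'a \<Rightarrow> real" where
  "prodB f g = (\<lambda>\<omega>. f \<omega> * g \<omega>)"

text \<open>
  Orthogonal projection onto a linear space \<open>V\<close> of random variables. It is used only for the
  span of finitely many orthonormal functions, whose elements are determined by their
  coefficients, so that the representative is unique as a function; see
  \<open>orth_proj_eq\<close> below.
\<close>

definition orth_proj :: "'a measure \<Rightarrow> ('a \<Rightarrow> real) set \<Rightarrow> ('a \<Rightarrow> real) \<Rightarrow> 'a \<Rightarrow> real" where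
  "orth_proj M V f = (THE g. g \<in> V \<and> (\<forall>h\<in>V. l2_inner M (\<lambda>\<omega>. f \<omega> - g \<omega>) h = 0))"

definition compl_proj :: "(('a \<Rightarrow> real) \<Rightarrow> 'a \<Rightarrow> real) \<Rightarrow> ('a \<Rightarrow> real) \<Rightarrow> 'a \<Rightarrow> real" where
  "compl_proj P f = (\<lambda>\<omega>. f \<omega> - P f \<omega>)"


section \<open>Generalized polynomial chaos\<close>

definition mdeg :: "('d::finite \<Rightarrow> nat) \<Rightarrow> nat" where
  "mdeg i = (\<Sum>k\<in>UNIV. i k)"

definition poly_of_degree :: "nat \<Rightarrow> (real ^ 'd::finite \<Rightarrow> real) \<Rightarrow> bool" where
  "poly_of_degree n p \<longleftrightarrow>
     (\<exists>c. (\<exists>j. mdeg j = n \<and> c j \<noteq> 0) \<and>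
          p = (\<lambda>x. \<Sum>j | mdeg j \<le> n. c j * (\<Prod>k\<in>UNIV. (x $ k) ^ j k)))"

definition gpc_span :: "('i \<Rightarrow> 'a \<Rightarrow> real) \<Rightarrow> 'i set \<Rightarrow> ('a \<Rightarrow> real) set" where
  "gpc_span \<Phi> S = {f. \<exists>a. f = (\<lambda>\<omega>. \<Sum>i\<in>S. a i * \<Phi> i \<omega>)}"

definition resolved :: "nat \<Rightarrow> ('d::finite \<Rightarrow> nat) set" where
  "resolved pr = {i. mdeg i \<le> pr}"

locale gpc_basis = prob_space M
  for M :: "'a measure" and \<xi> :: "'a \<Rightarrow> real ^ 'd::finite"
    and \<Phi> :: "('d \<Rightarrow> nat) \<Rightarrow> 'a \<Rightarrow> real" +
  assumes random_vector: "\<xi> \<in> borel_measurable M"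
    and polynomial: "\<And>i. \<exists>p. poly_of_degree (mdeg i) p \<and> (\<forall>\<omega>\<in>space M. \<Phi> i \<omega> = p (\<xi> \<omega>))"
    and orthonormal: "\<And>i j. l2_inner M (\<Phi> i) (\<Phi> j) = (if i = j then 1 else 0)"
    and spanning: "\<And>f \<epsilon>. square_integrable M f \<Longrightarrow> \<epsilon> > 0 \<Longrightarrow>
        \<exists>S g. finite S \<and> g \<in> gpc_span \<Phi> S \<and> l2_norm M (\<lambda>\<omega>. f \<omega> - g \<omega>) < \<epsilon>"


section \<open>The Kraichnan-Orszag system and its t-model\<close>

text \<open>Both systems are read pathwise, for almost every \<open>\<omega>\<close>.\<close>

definition kraichnan_orszag :: "'a measure \<Rightarrow> (3 \<Rightarrow> real \<Rightarrow> 'a \<Rightarrow> real) \<Rightarrow> bool" where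
  "kraichnan_orszag M y \<longleftrightarrow>
     (AE \<omega> in M. \<forall>t\<ge>0.
       ((\<lambda>s. y 1 s \<omega>) has_real_derivative y 1 t \<omega> * y 3 t \<omega>) (at t within {0..}) \<and>
       ((\<lambda>s. y 2 s \<omega>) has_real_derivative - (y 2 t \<omega> * y 3 t \<omega>)) (at t within {0..}) \<and>
       ((\<lambda>s. y 3 s \<omega>) has_real_derivative - (y 1 t \<omega>)\<^sup>2 + (y 2 t \<omega>)\<^sup>2) (at t within {0..}))"

definition Gamma1 :: "(('a \<Rightarrow> real) \<Rightarrow> 'a \<Rightarrow> real) \<Rightarrow> (3 \<Rightarrow> 'a \<Rightarrow> real) \<Rightarrow> 'a \<Rightarrow> real" where
  "Gamma1 P u = compl_proj P (prodB (u 1) (u 3))"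

definition Gamma2 :: "(('a \<Rightarrow> real) \<Rightarrow> 'a \<Rightarrow> real) \<Rightarrow> (3 \<Rightarrow> 'a \<Rightarrow> real) \<Rightarrow> 'a \<Rightarrow> real" where
  "Gamma2 P u = (\<lambda>\<omega>. - compl_proj P (prodB (u 2) (u 3)) \<omega>)"

definition Gamma3 :: "(('a \<Rightarrow> real) \<Rightarrow> 'a \<Rightarrow> real) \<Rightarrow> (3 \<Rightarrow> 'a \<Rightarrow> real) \<Rightarrow> 'a \<Rightarrow> real" where
  "Gamma3 P u = (\<lambda>\<omega>. - compl_proj P (prodB (u 1) (u 1)) \<omega> + compl_proj P (prodB (u 2) (u 2)) \<omega>)"

definition t_model_rhs1 ::
  "(('a \<Rightarrow> real) \<Rightarrow> 'a \<Rightarrow> real) \<Rightarrow> real \<Rightarrow> (3 \<Rightarrow> 'a \<Rightarrow> real) \<Rightarrow> 'a \<Rightarrow> real" where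
  "t_model_rhs1 P t u \<omega> =
     P (prodB (u 1) (u 3)) \<omega>
     + t * P (prodB (Gamma1 P u) (u 3)) \<omega>
     + t * P (prodB (u 1) (Gamma3 P u)) \<omega>"

definition t_model_rhs2 ::
  "(('a \<Rightarrow> real) \<Rightarrow> 'a \<Rightarrow> real) \<Rightarrow> real \<Rightarrow> (3 \<Rightarrow> 'a \<Rightarrow> real) \<Rightarrow> 'a \<Rightarrow> real" where
  "t_model_rhs2 P t u \<omega> =
     - P (prodB (u 2) (u 3)) \<omega>
     - t * P (prodB (Gamma2 P u) (u 3)) \<omega>
     - t * P (prodB (u 2) (Gamma3 P u)) \<omega>"

definition t_model_rhs3 ::
  "(('a \<Rightarrow> real) \<Rightarrow> 'a \<Rightarrow> real) \<Rightarrow> real \<Rightarrow> (3 \<Rightarrow> 'a \<Rightarrow> real) \<Rightarrow> 'a \<Rightarrow> real" where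
  "t_model_rhs3 P t u \<omega> =
     - P (prodB (u 1) (u 1)) \<omega> + P (prodB (u 2) (u 2)) \<omega>
     - t * P (\<lambda>\<omega>. prodB (Gamma1 P u) (u 1) \<omega> + prodB (u 1) (Gamma1 P u) \<omega>) \<omega>
     + t * P (\<lambda>\<omega>. prodB (Gamma2 P u) (u 2) \<omega> + prodB (u 2) (Gamma2 P u) \<omega>) \<omega>"

definition t_model ::
  "'a measure \<Rightarrow> (('a \<Rightarrow> real) \<Rightarrow> 'a \<Rightarrow> real) \<Rightarrow> (3 \<Rightarrow> real \<Rightarrow> 'a \<Rightarrow> real) \<Rightarrow> bool" where
  "t_model M P z \<longleftrightarrow>
     (AE \<omega> in M. \<forall>t\<ge>0.
       ((\<lambda>s. z 1 s \<omega>) has_real_derivative t_model_rhs1 P t (\<lambda>i. z i t) \<omega>) (at t within {0..}) \<and>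
       ((\<lambda>s. z 2 s \<omega>) has_real_derivative t_model_rhs2 P t (\<lambda>i. z i t) \<omega>) (at t within {0..}) \<and>
       ((\<lambda>s. z 3 s \<omega>) has_real_derivative t_model_rhs3 P t (\<lambda>i. z i t) \<omega>) (at t within {0..}))"


section \<open>The projection in coordinates\<close>

lemma finite_resolved: "finite (resolved pr :: ('d::finite \<Rightarrow> nat) set)"
proof (rule finite_subset)
  show "(resolved pr :: ('d \<Rightarrow> nat) set) \<subseteq> (\<Pi>\<^sub>E k\<in>UNIV. {..pr})"
  proof
    fix i :: "'d \<Rightarrow> nat" assume "i \<in> resolved pr"
    hence "mdeg i \<le> pr" by (simp add: resolved_def)
    moreover have "i k \<le> mdeg i" for k
      unfolding mdeg_def by (rule member_le_sum) auto
    ultimately show "i \<in> (\<Pi>\<^sub>E k\<in>UNIV. {..pr})" by (auto intro: order_trans)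
  qed
  show "finite ((\<Pi>\<^sub>E k\<in>UNIV. {..pr}) :: ('d \<Rightarrow> nat) set)" by (intro finite_PiE) auto
qed

lemma square_integrable_mult:
  assumes "square_integrable M f" "square_integrable M g"
  shows "integrable M (\<lambda>\<omega>. f \<omega> * g \<omega>)"
proof (rule Bochner_Integration.integrable_bound)
  show "integrable M (\<lambda>\<omega>. (f \<omega>)\<^sup>2 + (g \<omega>)\<^sup>2)"
    using assms by (auto simp: square_integrable_def)
  show "(\<lambda>\<omega>. f \<omega> * g \<omega>) \<in> borel_measurable M"
    using assms by (auto simp: square_integrable_def)
  have "\<bar>a * b\<bar> \<le> a\<^sup>2 + b\<^sup>2" for a b :: real
  proof -
    have "2 * (\<bar>a\<bar> * \<bar>b\<bar>) \<le> a\<^sup>2 + b\<^sup>2"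
      using sum_squares_bound[of "\<bar>a\<bar>" "\<bar>b\<bar>"] by simp
    moreover have "0 \<le> \<bar>a\<bar> * \<bar>b\<bar>" by simp
    ultimately show ?thesis unfolding abs_mult by linarith
  qed
  thus "AE \<omega> in M. norm (f \<omega> * g \<omega>) \<le> norm ((f \<omega>)\<^sup>2 + (g \<omega>)\<^sup>2)" by simp
qed

context gpc_basis
begin

lemma square_integrable_basis: "square_integrable M (\<Phi> i)"
proof -
  obtain p where p: "poly_of_degree (mdeg i) p" "\<forall>\<omega>\<in>space M. \<Phi> i \<omega> = p (\<xi> \<omega>)"
    using polynomial by blast
  have "p \<in> borel_measurable borel"
    using p(1) unfolding poly_of_degree_def by auto
  hence "(\<lambda>\<omega>. p (\<xi> \<omega>)) \<in> borel_measurable M"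
    using random_vector by measurable
  hence "\<Phi> i \<in> borel_measurable M"
    using p(2) by (simp cong: measurable_cong)
  moreover have "integrable M (\<lambda>\<omega>. (\<Phi> i \<omega>)\<^sup>2)"
    using orthonormal[of i i] not_integrable_integral_eq
    by (fastforce simp: l2_inner_def power2_eq_square)
  ultimately show ?thesis by (simp add: square_integrable_def)
qed

lemma l2_inner_diff_span:
  assumes "finite S" and "\<And>k. k \<in> S \<Longrightarrow> integrable M (\<lambda>\<omega>. f \<omega> * \<Phi> k \<omega>)" and "k \<in> S"
  shows "l2_inner M (\<lambda>\<omega>. f \<omega> - (\<Sum>i\<in>S. a i * \<Phi> i \<omega>)) (\<Phi> k) = l2_inner M f (\<Phi> k) - a k"
    and "integrable M (\<lambda>\<omega>. (f \<omega> - (\<Sum>i\<in>S. a i * \<Phi> i \<omega>)) * \<Phi> k \<omega>)"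
proof -
  have int: "integrable M (\<lambda>\<omega>. \<Phi> i \<omega> * \<Phi> k \<omega>)" for i
    by (intro square_integrable_mult square_integrable_basis)
  have eq: "(\<lambda>\<omega>. (f \<omega> - (\<Sum>i\<in>S. a i * \<Phi> i \<omega>)) * \<Phi> k \<omega>)
     = (\<lambda>\<omega>. f \<omega> * \<Phi> k \<omega> - (\<Sum>i\<in>S. a i * (\<Phi> i \<omega> * \<Phi> k \<omega>)))"
    by (auto simp: algebra_simps sum_distrib_left)
  show "integrable M (\<lambda>\<omega>. (f \<omega> - (\<Sum>i\<in>S. a i * \<Phi> i \<omega>)) * \<Phi> k \<omega>)"
    unfolding eq using assms int by auto
  have "l2_inner M (\<lambda>\<omega>. f \<omega> - (\<Sum>i\<in>S. a i * \<Phi> i \<omega>)) (\<Phi> k)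
      = l2_inner M f (\<Phi> k) - (\<Sum>i\<in>S. a i * l2_inner M (\<Phi> i) (\<Phi> k))"
    unfolding l2_inner_def eq using assms int by simp
  also have "(\<Sum>i\<in>S. a i * l2_inner M (\<Phi> i) (\<Phi> k)) = a k"
    using assms by (simp add: orthonormal if_distrib cong: if_cong)
  finally show "l2_inner M (\<lambda>\<omega>. f \<omega> - (\<Sum>i\<in>S. a i * \<Phi> i \<omega>)) (\<Phi> k) = l2_inner M f (\<Phi> k) - a k" .
qed

lemma orth_proj_eq:
  assumes S: "finite S" and f: "\<And>k. k \<in> S \<Longrightarrow> integrable M (\<lambda>\<omega>. f \<omega> * \<Phi> k \<omega>)"
  shows "orth_proj M (gpc_span \<Phi> S) f = (\<lambda>\<omega>. \<Sum>i\<in>S. l2_inner M f (\<Phi> i) * \<Phi> i \<omega>)"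
  unfolding orth_proj_def
proof (rule the_equality, intro conjI ballI)
  let ?g = "\<lambda>\<omega>. \<Sum>i\<in>S. l2_inner M f (\<Phi> i) * \<Phi> i \<omega>"
  show "?g \<in> gpc_span \<Phi> S" by (auto simp: gpc_span_def)
  fix h assume "h \<in> gpc_span \<Phi> S"
  then obtain b where b: "h = (\<lambda>\<omega>. \<Sum>i\<in>S. b i * \<Phi> i \<omega>)" by (auto simp: gpc_span_def)
  have "l2_inner M (\<lambda>\<omega>. f \<omega> - ?g \<omega>) h
      = (LINT \<omega>|M. (\<Sum>k\<in>S. b k * ((f \<omega> - ?g \<omega>) * \<Phi> k \<omega>)))"
    unfolding l2_inner_def b by (simp add: sum_distrib_left mult.left_commute)
  also have "\<dots> = (\<Sum>k\<in>S. b k * l2_inner M (\<lambda>\<omega>. f \<omega> - ?g \<omega>) (\<Phi> k))"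
    using l2_inner_diff_span(2)[OF S f] by (simp add: l2_inner_def)
  also have "\<dots> = 0"
    using l2_inner_diff_span(1)[OF S f] by (intro sum.neutral) simp
  finally show "l2_inner M (\<lambda>\<omega>. f \<omega> - ?g \<omega>) h = 0" .
next
  fix g assume g: "g \<in> gpc_span \<Phi> S \<and> (\<forall>h\<in>gpc_span \<Phi> S. l2_inner M (\<lambda>\<omega>. f \<omega> - g \<omega>) h = 0)"
  then obtain a where a: "g = (\<lambda>\<omega>. \<Sum>i\<in>S. a i * \<Phi> i \<omega>)" by (auto simp: gpc_span_def)
  have "a k = l2_inner M f (\<Phi> k)" if k: "k \<in> S" for k
  proof -
    have "\<Phi> k = (\<lambda>\<omega>. \<Sum>i\<in>S. (if i = k then 1 else 0) * \<Phi> i \<omega>)"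
      using S k by (simp add: if_distrib[of "\<lambda>x. x * _"] cong: if_cong)
    hence "\<Phi> k \<in> gpc_span \<Phi> S"
      unfolding gpc_span_def by (intro CollectI exI[of _ "\<lambda>i. if i = k then 1 else 0"])
    hence "l2_inner M (\<lambda>\<omega>. f \<omega> - g \<omega>) (\<Phi> k) = 0" using g by blast
    thus ?thesis using l2_inner_diff_span(1)[OF S f k] a by simp
  qed
  thus "g = (\<lambda>\<omega>. \<Sum>i\<in>S. l2_inner M f (\<Phi> i) * \<Phi> i \<omega>)" unfolding a by auto
qed

end

end

theory Submission
  imports Defs "HOL-Library.Function_Algebras"
begin

text \<open>
  Write \<open>u = P y\<close>, \<open>w = (I - P) y\<close>, \<open>e = z - u\<close>. All moments of \<open>\<xi>\<close> are finite, because the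
  \<open>\<Phi> i\<close> of degree at most \<open>n\<close> are orthonormal and as numerous as the monomials of degree at most
  \<open>n\<close>; hence every resolved function is dominated by its norm times an envelope
  \<open>K = \<Sum>\<bar>\<Phi> k\<bar>\<close> that has all moments. The three-mode system conserves
  \<open>R\<^sup>2 = y\<^sub>1\<^sup>2 + y\<^sub>2\<^sup>2 + y\<^sub>3\<^sup>2\<close> pathwise and the t-model dissipates \<open>\<parallel>z\<parallel>\<^sup>2\<close>, so \<open>u\<close> and \<open>z\<close> are bounded by
  a constant times \<open>K\<close>, uniformly in time. The differences of the quadratic terms and the memory terms
  are then estimated by the Cauchy-Schwarz inequality and Young's inequality.

  The only delicate term is quadratic in \<open>w\<close>, for which one needs \<open>\<integral> K R \<bar>w\<bar> \<le> C \<parallel>w\<parallel>\<close> uniformly in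
  time although only \<open>\<integral> K R\<^sup>2\<close> is known to be finite. If \<open>\<parallel>w\<parallel>\<close> is bounded away from \<open>0\<close> this is trivial.
  Otherwise \<open>y\<close> comes arbitrarily close to the bounded set of the \<open>u\<close>, and since \<open>R\<close> is conserved
  it is itself dominated by a multiple of \<open>K\<close>, so that the Cauchy-Schwarz inequality applies.
\<close>

section \<open>Linear systems and differentiation under the integral\<close>

text \<open>The rows of \<open>C\<close>, extended by zero outside \<open>J\<close>, are
  \<open>card J\<close> independent functions in a space generated by \<open>card J\<close> unit
  functions; hence they span it and produce every \<open>r\<close>. This is the dimension count
  behind expressing monomials through the basis functions.\<close>

lemma square_system_solvable:
  fixes C :: "'b \<Rightarrow> 'b \<Rightarrow> real"
  assumes J: "finite J"
    and rows: "\<And>b. (\<And>j. j \<in> J \<Longrightarrow> (\<Sum>i\<in>J. b i * C i j) = 0) \<Longrightarrow> (\<And>i. i \<in> J \<Longrightarrow> b i = 0)"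
  shows "\<exists>d. \<forall>j\<in>J. (\<Sum>i\<in>J. d i * C i j) = r j"
proof -
  interpret V: vector_space "\<lambda>(a::real) (f :: 'b \<Rightarrow> real) x. a * f x"
    by unfold_locales (auto simp: fun_eq_iff algebra_simps)
  define v where "v = (\<lambda>i j. if j \<in> J then C i j else 0)"
  define \<delta> where "\<delta> = (\<lambda>(i::'b) j. if i = j then 1 else (0::real))"
  have sum_app: "(\<Sum>a\<in>A. f a) x = (\<Sum>a\<in>A. f a x)" if "finite A" for A :: "'c set" and f :: "'c \<Rightarrow> 'b \<Rightarrow> real" and x
    using that by (induction A rule: finite_induct) auto
  have comb: "(\<Sum>i\<in>J. (\<lambda>x. b i * v i x)) j = (if j \<in> J then \<Sum>i\<in>J. b i * C i j else 0)" for b j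
    using J by (subst sum_app) (auto simp: v_def)
  have zero: "b i = 0" if "(\<Sum>i\<in>J. (\<lambda>x. b i * v i x)) = 0" "i \<in> J" for b i
  proof (rule rows[of b i])
    fix j assume "j \<in> J"
    then show "(\<Sum>i\<in>J. b i * C i j) = 0" using that(1) comb[of b j] by simp
  qed (rule that)
  \<comment> \<open>Independence is a property of the set of rows, so equal rows must be excluded
    first: they would give a vanishing combination with coefficients
    \<open>\<delta> i - \<delta> i'\<close>.\<close>
  have inj: "inj_on v J"
  proof (rule inj_onI, rule ccontr)
    fix i i' assume h: "i \<in> J" "i' \<in> J" "v i = v i'" "i \<noteq> i'"
    let ?b = "\<lambda>k. \<delta> i k - \<delta> i' k"
    have "(\<Sum>k\<in>J. (\<lambda>x. ?b k * v k x)) = 0"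
    proof
      fix j
      have "(\<Sum>k\<in>J. (\<lambda>x. ?b k * v k x)) j = (\<Sum>k\<in>J. \<delta> i k * v k j) - (\<Sum>k\<in>J. \<delta> i' k * v k j)"
        using J by (subst sum_app) (auto simp: algebra_simps sum_subtractf)
      also have "\<dots> = v i j - v i' j"
        using J h by (simp add: \<delta>_def if_distrib[of "\<lambda>x. x * _"] cong: if_cong)
      finally show "(\<Sum>k\<in>J. (\<lambda>x. ?b k * v k x)) j = 0 j" using h by simp
    qed
    from zero[OF this h(1)] h(4) show False by (simp add: \<delta>_def)
  qed
  have ind: "V.independent (v ` J)"
  proof (rule V.independent_if_scalars_zero)
    show "finite (v ` J)" using J by simp
    fix f x assume "(\<Sum>x\<in>v ` J. (\<lambda>y. f x * x y)) = 0" "x \<in> v ` J"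
    then show "f x = 0"
      using zero[of "f \<circ> v"] by (auto simp: sum.reindex[OF inj] o_def)
  qed
  have \<delta>sum: "f = (\<Sum>j\<in>J. (\<lambda>x. f j * \<delta> j x))" if "\<And>j. j \<notin> J \<Longrightarrow> f j = 0" for f
  proof
    fix x show "f x = (\<Sum>j\<in>J. (\<lambda>x. f j * \<delta> j x)) x"
      using J that by (subst sum_app) (auto simp: \<delta>_def if_distrib cong: if_cong)
  qed
  have in_span: "f \<in> V.span (\<delta> ` J)" if "\<And>j. j \<notin> J \<Longrightarrow> f j = 0" for f
    by (subst \<delta>sum[OF that], assumption)
       (intro V.span_sum V.span_scale V.span_base, auto)
  have card_\<delta>: "card (\<delta> ` J) = card J"
  proof (intro card_image inj_onI)
    fix i k assume "\<delta> i = \<delta> k"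
    then have "\<delta> i i = \<delta> k i" by simp
    then show "i = k" by (simp add: \<delta>_def split: if_splits)
  qed
  have "card (v ` J) = card J" by (rule card_image[OF inj])
  \<comment> \<open>A function outside the span of the rows could be added to them, giving
    \<open>card J + 1\<close> independent elements in a space with \<open>card J\<close>
    generators.\<close>
  have span: "V.span (\<delta> ` J) \<subseteq> V.span (v ` J)"
  proof (rule ccontr)
    assume "\<not> ?thesis"
    then obtain f where f: "f \<in> V.span (\<delta> ` J)" "f \<notin> V.span (v ` J)" by blast
    have "f \<notin> v ` J" using f(2) by (rule contrapos_nn) (rule V.span_base)
    have ind': "V.independent (insert f (v ` J))" using f(2) ind by (rule V.independent_insertI)
    have sub: "insert f (v ` J) \<subseteq> V.span (\<delta> ` J)" using f in_span by (auto simp: v_def)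
    have "card (insert f (v ` J)) \<le> card (\<delta> ` J)"
      by (rule conjunct2[OF V.independent_span_bound[OF finite_imageI[OF J] ind' sub]])
    with card_\<delta> \<open>card (v ` J) = card J\<close> \<open>f \<notin> v ` J\<close> J show False by simp
  qed
  have "(\<lambda>j. if j \<in> J then r j else 0) \<in> V.span (v ` J)"
    using in_span span by auto
  then obtain u where "(\<lambda>j. if j \<in> J then r j else 0) = (\<Sum>w\<in>v ` J. (\<lambda>x. u w * w x))"
    using J by (auto simp: V.span_finite)
  then have eq: "(\<lambda>j. if j \<in> J then r j else 0) = (\<Sum>i\<in>J. (\<lambda>x. u (v i) * v i x))"
    by (simp add: sum.reindex[OF inj])
  have "(\<Sum>i\<in>J. u (v i) * C i j) = r j" if "j \<in> J" for j
    using trans[OF fun_cong[OF eq, of j] comb[of "\<lambda>i. u (v i)" j]] that by (simp only: if_True)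
  then show ?thesis by (intro exI[of _ "\<lambda>i. u (v i)"] ballI)
qed

text \<open>Gaussian elimination: a point where \<open>\<phi> j\<close> does not vanish eliminates the coefficient \<open>a j\<close>.\<close>

lemma coefficients_have_derivative:
  fixes \<phi> :: "'i \<Rightarrow> 'a \<Rightarrow> real"
  assumes "finite S"
    and "\<And>b. (\<And>x. x \<in> G \<Longrightarrow> (\<Sum>i\<in>S. b i * \<phi> i x) = 0) \<Longrightarrow> (\<And>i. i \<in> S \<Longrightarrow> b i = 0)"
    and "\<And>x. x \<in> G \<Longrightarrow>
      ((\<lambda>s. \<Sum>i\<in>S. a i s * \<phi> i x) has_real_derivative (\<Sum>i\<in>S. d i * \<phi> i x)) (at t within X)"
    and "i \<in> S"
  shows "((\<lambda>s. a i s) has_real_derivative d i) (at t within X)"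
  using assms
proof (induction S arbitrary: \<phi> i rule: finite_induct)
  case empty
  then show ?case by simp
next
  case (insert j S)
  have "\<exists>x0\<in>G. \<phi> j x0 \<noteq> 0"
  proof (rule ccontr)
    assume "\<not> ?thesis"
    then have "(\<Sum>i\<in>insert j S. (if i = j then 1 else 0) * \<phi> i x) = 0" if "x \<in> G" for x
      using that insert.hyps by (intro sum.neutral) auto
    from insert.prems(1)[OF this, of j] show False by simp
  qed
  then obtain x0 where x0: "x0 \<in> G" "\<phi> j x0 \<noteq> 0" by blast
  define q where "q = (\<lambda>x. \<phi> j x / \<phi> j x0)"
  define \<psi> where "\<psi> = (\<lambda>i x. \<phi> i x - \<phi> i x0 * q x)"
  have qj: "q x * \<phi> j x0 = \<phi> j x" for x using x0 by (simp add: q_def)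
  have elim: "(\<Sum>i\<in>S. c i * \<psi> i x)
      = (\<Sum>i\<in>insert j S. c i * \<phi> i x) - q x * (\<Sum>i\<in>insert j S. c i * \<phi> i x0)" for c x
    using insert.hyps qj[of x]
    by (simp add: \<psi>_def algebra_simps sum_subtractf sum_distrib_left)
  have rest: "((\<lambda>s. a i s) has_real_derivative d i) (at t within X)" if "i \<in> S" for i
  proof (rule insert.IH[OF _ _ that])
    fix b k assume b: "\<And>x. x \<in> G \<Longrightarrow> (\<Sum>i\<in>S. b i * \<psi> i x) = 0" and k: "k \<in> S"
    \<comment> \<open>Extends a relation among the \<open>\<psi> i\<close> to one among all
      \<open>\<phi> i\<close>; the coefficient at \<open>j\<close> makes the combination vanish at
      \<open>x0\<close>.\<close>
    define b' where "b' = (\<lambda>i. if i = j then - (\<Sum>i\<in>S. b i * \<phi> i x0) / \<phi> j x0 else b i)"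
    have S': "(\<Sum>i\<in>S. b' i * f i) = (\<Sum>i\<in>S. b i * f i)" for f
      using insert.hyps by (intro sum.cong) (auto simp: b'_def)
    have "(\<Sum>i\<in>insert j S. b' i * \<phi> i x) = (\<Sum>i\<in>S. b i * \<psi> i x)" for x
      using insert.hyps S'[of "\<lambda>i. \<phi> i x"] x0
      by (simp add: \<psi>_def q_def b'_def[THEN fun_cong, of j] algebra_simps sum_subtractf
           sum_distrib_left sum_divide_distrib)
    then have "(\<Sum>i\<in>insert j S. b' i * \<phi> i x) = 0" if "x \<in> G" for x using b that by simp
    from insert.prems(1)[OF this, of k] k insert.hyps show "b k = 0" by (auto simp: b'_def split: if_splits)
  next
    fix x assume x: "x \<in> G"
    show "((\<lambda>s. \<Sum>i\<in>S. a i s * \<psi> i x) has_real_derivative (\<Sum>i\<in>S. d i * \<psi> i x)) (at t within X)"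
      unfolding elim[of d] using elim[of "\<lambda>i. a i _"]
      by (simp only: elim[of "\<lambda>i. a i _"])
        (intro DERIV_diff DERIV_cmult insert.prems(2) x x0)
  qed
  show ?case
  proof (cases "i = j")
    case False
    then show ?thesis using rest insert.prems by simp
  next
    case True
    \<comment> \<open>Evaluation at \<open>x0\<close> recovers the eliminated coefficient from the
      full sum and the coefficients already treated.\<close>
    have a: "a j = (\<lambda>s. ((\<Sum>i\<in>insert j S. a i s * \<phi> i x0) - (\<Sum>i\<in>S. a i s * \<phi> i x0)) / \<phi> j x0)"
      using insert.hyps x0 by simp
    have d: "d j = ((\<Sum>i\<in>insert j S. d i * \<phi> i x0) - (\<Sum>i\<in>S. d i * \<phi> i x0)) / \<phi> j x0"
      using insert.hyps x0 by simp
    show ?thesis unfolding True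
      by (subst a, subst d)
        (intro DERIV_cdivide DERIV_diff insert.prems(2) x0 DERIV_sum DERIV_cmult_right rest)
  qed
qed

text \<open>Dominated convergence along sequences: by the mean value inequality on the convex set
  \<open>X\<close>, the bound \<open>g\<close> on the derivatives also bounds every difference
  quotient. A half-line is allowed for \<open>X\<close>, which covers the one-sided derivative at
  time 0.\<close>

lemma has_real_derivative_integral:
  fixes f f' :: "real \<Rightarrow> 'a \<Rightarrow> real"
  assumes int: "\<And>s. s \<in> X \<Longrightarrow> integrable M (f s)" and X: "convex X" and t: "t \<in> X"
    and f': "f' t \<in> borel_measurable M" and g: "integrable M g"
    and AE: "AE \<omega> in M. \<forall>s\<in>X. ((\<lambda>s. f s \<omega>) has_real_derivative f' s \<omega>) (at s within X) \<and> \<bar>f' s \<omega>\<bar> \<le> g \<omega>"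
  shows "((\<lambda>s. LINT \<omega>|M. f s \<omega>) has_real_derivative (LINT \<omega>|M. f' t \<omega>)) (at t within X)"
  unfolding has_field_derivative_iff tendsto_at_iff_sequentially
proof (intro allI impI)
  fix S :: "nat \<Rightarrow> real" assume S: "\<forall>i. S i \<in> X - {t}" and lim: "S \<longlonglongrightarrow> t"
  have "(\<lambda>n. LINT \<omega>|M. (f (S n) \<omega> - f t \<omega>) / (S n - t)) \<longlonglongrightarrow> (LINT \<omega>|M. f' t \<omega>)"
  proof (rule integral_dominated_convergence[OF f' _ g])
    show "(\<lambda>\<omega>. (f (S n) \<omega> - f t \<omega>) / (S n - t)) \<in> borel_measurable M" for n
      using int[THEN borel_measurable_integrable] S t by (intro borel_measurable_divide borel_measurable_diff) auto
    show "AE \<omega> in M. (\<lambda>n. (f (S n) \<omega> - f t \<omega>) / (S n - t)) \<longlonglongrightarrow> f' t \<omega>"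
      using AE
    proof eventually_elim
      case (elim \<omega>)
      then have "((\<lambda>s. f s \<omega>) has_real_derivative f' t \<omega>) (at t within X)" using t by blast
      then show ?case unfolding has_field_derivative_iff tendsto_at_iff_sequentially
        using S lim by (auto simp: o_def)
    qed
    show "AE \<omega> in M. norm ((f (S n) \<omega> - f t \<omega>) / (S n - t)) \<le> g \<omega>" for n
      using AE
    proof eventually_elim
      case (elim \<omega>)
      have "norm (f (S n) \<omega> - f t \<omega>) \<le> g \<omega> * norm (S n - t)"
        by (rule field_differentiable_bound[OF X, of "\<lambda>s. f s \<omega>" "\<lambda>s. f' s \<omega>"])
          (use elim S t in auto)
      moreover have "S n - t \<noteq> 0" using S by auto
      ultimately show ?case by (simp add: field_simps)
    qed
  qed
  moreover have "(LINT \<omega>|M. (f (S n) \<omega> - f t \<omega>) / (S n - t)) =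
     ((LINT \<omega>|M. f (S n) \<omega>) - (LINT \<omega>|M. f t \<omega>)) / (S n - t)" for n
    using int[of "S n"] int[OF t] S by simp
  ultimately have "(\<lambda>n. ((LINT \<omega>|M. f (S n) \<omega>) - (LINT \<omega>|M. f t \<omega>)) / (S n - t)) \<longlonglongrightarrow> (LINT \<omega>|M. f' t \<omega>)"
    by (simp only:)
  then show "((\<lambda>s. ((LINT \<omega>|M. f s \<omega>) - (LINT \<omega>|M. f t \<omega>)) / (s - t)) \<circ> S) \<longlonglongrightarrow> (LINT \<omega>|M. f' t \<omega>)"
    by (simp add: o_def)
qed

section \<open>Square-integrable functions\<close>

lemma square_integrable_measurable:
  "square_integrable M f \<Longrightarrow> f \<in> borel_measurable M"
  by (simp add: square_integrable_def)

lemma square_integrable_cmult: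
  "square_integrable M f \<Longrightarrow> square_integrable M (\<lambda>\<omega>. c * f \<omega>)"
  by (auto simp: square_integrable_def power_mult_distrib)

lemma square_integrable_abs:
  "square_integrable M f \<Longrightarrow> square_integrable M (\<lambda>\<omega>. \<bar>f \<omega>\<bar>)"
  by (auto simp: square_integrable_def)

lemma square_integrable_add:
  assumes "square_integrable M f" "square_integrable M g"
  shows "square_integrable M (\<lambda>\<omega>. f \<omega> + g \<omega>)"
  using assms square_integrable_mult[OF assms]
  by (auto simp: square_integrable_def power2_sum mult.assoc)

lemma square_integrable_diff:
  assumes "square_integrable M f" "square_integrable M g"
  shows "square_integrable M (\<lambda>\<omega>. f \<omega> - g \<omega>)"
  using assms square_integrable_mult[OF assms]
  by (auto simp: square_integrable_def power2_diff mult.assoc)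

lemma square_integrable_sum:
  assumes "\<And>i. i \<in> I \<Longrightarrow> square_integrable M (f i)"
  shows "square_integrable M (\<lambda>\<omega>. \<Sum>i\<in>I. f i \<omega>)"
proof (cases "finite I")
  case True
  then show ?thesis using assms
  proof (induction I rule: finite_induct)
    case empty
    then show ?case by (simp add: square_integrable_def)
  next
    case (insert i I)
    then show ?case by (simp add: square_integrable_add)
  qed
qed (simp add: square_integrable_def)

lemma square_integrable_bound:
  assumes "square_integrable M f" "g \<in> borel_measurable M" "AE \<omega> in M. \<bar>g \<omega>\<bar> \<le> \<bar>f \<omega>\<bar>"
  shows "square_integrable M g"
  unfolding square_integrable_def
proof
  show "integrable M (\<lambda>\<omega>. (g \<omega>)\<^sup>2)"
  proof (rule Bochner_Integration.integrable_bound)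
    show "integrable M (\<lambda>\<omega>. (f \<omega>)\<^sup>2)" using assms(1) by (simp add: square_integrable_def)
    show "(\<lambda>\<omega>. (g \<omega>)\<^sup>2) \<in> borel_measurable M" using assms(2) by simp
    show "AE \<omega> in M. norm ((g \<omega>)\<^sup>2) \<le> norm ((f \<omega>)\<^sup>2)"
      using assms(3) by eventually_elim (simp add: abs_le_square_iff)
  qed
qed fact

lemma l2_norm_nonneg: "0 \<le> l2_norm M f"
  by (simp add: l2_norm_def l2_inner_def integral_nonneg_AE)

lemma l2_norm_sq: "(l2_norm M f)\<^sup>2 = l2_inner M f f"
  by (simp add: l2_norm_def l2_inner_def integral_nonneg_AE)

text \<open>The mean of the square of \<open>s * \<bar>f\<bar> - \<bar>g\<bar>\<close> is
  nonnegative for every real \<open>s\<close>. The absolute values stay inside the integral because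
  the later estimates start from pointwise bounds.\<close>

lemma Cauchy_Schwarz_abs:
  assumes f: "square_integrable M f" and g: "square_integrable M g"
  shows "(LINT \<omega>|M. \<bar>f \<omega>\<bar> * \<bar>g \<omega>\<bar>) \<le> l2_norm M f * l2_norm M g"
proof -
  let ?X = "l2_norm M f" and ?Y = "l2_norm M g" and ?Z = "LINT \<omega>|M. \<bar>f \<omega>\<bar> * \<bar>g \<omega>\<bar>"
  have quad: "0 \<le> s\<^sup>2 * ?X\<^sup>2 - 2 * s * ?Z + ?Y\<^sup>2" for s
  proof -
    have i: "integrable M (\<lambda>\<omega>. \<bar>f \<omega>\<bar> * \<bar>g \<omega>\<bar>)"
      using f g by (intro square_integrable_mult square_integrable_abs)
    have "0 \<le> (LINT \<omega>|M. (s * \<bar>f \<omega>\<bar> - \<bar>g \<omega>\<bar>)\<^sup>2)" by (intro integral_nonneg_AE) auto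
    also have "(\<lambda>\<omega>. (s * \<bar>f \<omega>\<bar> - \<bar>g \<omega>\<bar>)\<^sup>2)
        = (\<lambda>\<omega>. s\<^sup>2 * (f \<omega>)\<^sup>2 - 2 * s * (\<bar>f \<omega>\<bar> * \<bar>g \<omega>\<bar>) + (g \<omega>)\<^sup>2)"
      by (auto simp: power2_diff power_mult_distrib algebra_simps)
    also have "(LINT \<omega>|M. s\<^sup>2 * (f \<omega>)\<^sup>2 - 2 * s * (\<bar>f \<omega>\<bar> * \<bar>g \<omega>\<bar>) + (g \<omega>)\<^sup>2)
        = s\<^sup>2 * ?X\<^sup>2 - 2 * s * ?Z + ?Y\<^sup>2"
      using f g i by (simp add: l2_norm_sq l2_inner_def square_integrable_def power2_eq_square[of "f _"]
          power2_eq_square[of "g _"])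
    finally show ?thesis .
  qed
  have Z: "0 \<le> ?Z" by (intro integral_nonneg_AE) auto
  have "?Z\<^sup>2 \<le> (?X * ?Y)\<^sup>2"
  proof (cases "?X = 0")
    case True
    have "?Z = 0"
    proof (rule ccontr)
      assume "?Z \<noteq> 0"
      \<comment> \<open>For \<open>?X = 0\<close> the quadratic is affine in \<open>s\<close>, and
        at this \<open>s\<close> it would be negative.\<close>
      then have "2 * ((?Y\<^sup>2 + 1) / ?Z) * ?Z = 2 * (?Y\<^sup>2 + 1)" by simp
      with quad[of "(?Y\<^sup>2 + 1) / ?Z"] True have "2 * ?Y\<^sup>2 + 2 \<le> ?Y\<^sup>2" by (simp only:) simp
      then show False using zero_le_power2[of ?Y] by linarith
    qed
    then show ?thesis by simp
  next
    case False
    \<comment> \<open>\<open>?Z / ?X\<^sup>2\<close> is the minimiser of the quadratic.\<close>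
    then have "0 \<le> (?Z / ?X\<^sup>2)\<^sup>2 * ?X\<^sup>2 - 2 * (?Z / ?X\<^sup>2) * ?Z + ?Y\<^sup>2 \<Longrightarrow> 0 \<le> ?Y\<^sup>2 - ?Z\<^sup>2 / ?X\<^sup>2"
      by (simp add: power2_eq_square)
    with quad[of "?Z / ?X\<^sup>2"] have "?Z\<^sup>2 / ?X\<^sup>2 \<le> ?Y\<^sup>2" by simp
    then show ?thesis using False
      by (simp add: divide_le_eq power_mult_distrib mult.commute)
  qed
  then show ?thesis
    by (rule power2_le_imp_le) (intro mult_nonneg_nonneg l2_norm_nonneg)
qed

lemma Cauchy_Schwarz_l2:
  assumes "square_integrable M f" "square_integrable M g"
  shows "\<bar>l2_inner M f g\<bar> \<le> l2_norm M f * l2_norm M g"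
  unfolding l2_inner_def
  by (rule order_trans[OF integral_abs_bound])
    (use Cauchy_Schwarz_abs[OF assms] in \<open>simp add: abs_mult\<close>)

lemma l2_norm_triangle:
  assumes "square_integrable M f" "square_integrable M g"
  shows "l2_norm M (\<lambda>\<omega>. f \<omega> + g \<omega>) \<le> l2_norm M f + l2_norm M g"
proof (rule power2_le_imp_le)
  have "(\<lambda>\<omega>. (f \<omega> + g \<omega>) * (f \<omega> + g \<omega>)) = (\<lambda>\<omega>. f \<omega> * f \<omega> + 2 * (f \<omega> * g \<omega>) + g \<omega> * g \<omega>)"
    by (auto simp: algebra_simps)
  then have "l2_inner M (\<lambda>\<omega>. f \<omega> + g \<omega>) (\<lambda>\<omega>. f \<omega> + g \<omega>)
     = l2_inner M f f + 2 * l2_inner M f g + l2_inner M g g"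
    using square_integrable_mult[OF assms(1,1)] square_integrable_mult[OF assms]
      square_integrable_mult[OF assms(2,2)]
    by (simp add: l2_inner_def)
  then show "(l2_norm M (\<lambda>\<omega>. f \<omega> + g \<omega>))\<^sup>2 \<le> (l2_norm M f + l2_norm M g)\<^sup>2"
    using Cauchy_Schwarz_l2[OF assms] by (simp add: l2_norm_sq power2_sum)
qed (intro add_nonneg_nonneg l2_norm_nonneg)

lemma l2_norm_mono:
  assumes "square_integrable M g" "f \<in> borel_measurable M" "AE \<omega> in M. \<bar>f \<omega>\<bar> \<le> \<bar>g \<omega>\<bar>"
  shows "l2_norm M f \<le> l2_norm M g"
  unfolding l2_norm_def l2_inner_def
proof (rule real_sqrt_le_mono, rule integral_mono_AE)
  have "square_integrable M f" using assms by (rule square_integrable_bound)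
  then show "integrable M (\<lambda>\<omega>. f \<omega> * f \<omega>)" "integrable M (\<lambda>\<omega>. g \<omega> * g \<omega>)"
    using assms by (auto intro: square_integrable_mult)
  show "AE \<omega> in M. f \<omega> * f \<omega> \<le> g \<omega> * g \<omega>"
    using assms(3) by eventually_elim (simp add: abs_le_square_iff flip: power2_eq_square)
qed

lemma l2_norm_cmult: "l2_norm M (\<lambda>\<omega>. c * f \<omega>) = \<bar>c\<bar> * l2_norm M f"
proof -
  have "l2_inner M (\<lambda>\<omega>. c * f \<omega>) (\<lambda>\<omega>. c * f \<omega>) = (LINT \<omega>|M. (c * c) * (f \<omega> * f \<omega>))"
    unfolding l2_inner_def by (simp add: ac_simps)
  also have "\<dots> = (c * c) * l2_inner M f f"
    unfolding l2_inner_def by (rule integral_mult_right_zero)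
  finally show ?thesis unfolding l2_norm_def by (simp add: real_sqrt_mult)
qed

lemma l2_norm_vec_sq: "(l2_norm_vec M f)\<^sup>2 = (\<Sum>i\<in>UNIV. (l2_norm M (f i))\<^sup>2)"
  by (simp add: l2_norm_vec_def L2_set_def sum_nonneg)

lemma l2_norm_vec_nonneg: "0 \<le> l2_norm_vec M f"
  by (simp add: l2_norm_vec_def L2_set_nonneg)

lemma l2_norm_le_vec: "l2_norm M (f i) \<le> l2_norm_vec M f"
  unfolding l2_norm_vec_def by (rule member_le_L2_set) auto

section \<open>Functions with finite moments\<close>

text \<open>Square integrability is not stable under products. Finite moments of every order define
  an algebra, so the cubic expressions of the memory terms stay in the class.\<close>

definition all_moments :: "'a measure \<Rightarrow> ('a \<Rightarrow> real) \<Rightarrow> bool" where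
  "all_moments M f \<longleftrightarrow> f \<in> borel_measurable M \<and> (\<forall>n. integrable M (\<lambda>\<omega>. \<bar>f \<omega>\<bar> ^ n))"

lemma all_moments_measurable: "all_moments M f \<Longrightarrow> f \<in> borel_measurable M"
  by (simp add: all_moments_def)

lemma all_moments_square_integrable: "all_moments M f \<Longrightarrow> square_integrable M f"
  unfolding all_moments_def square_integrable_def by (auto dest!: spec[of _ "2::nat"])

lemma all_moments_integrable:
  assumes "all_moments M f"
  shows "integrable M f"
proof (rule integrable_abs_cancel)
  have "integrable M (\<lambda>\<omega>. \<bar>f \<omega>\<bar> ^ 1)" using assms unfolding all_moments_def by blast
  then show "integrable M (\<lambda>\<omega>. \<bar>f \<omega>\<bar>)" by simp
qed (use assms in \<open>simp add: all_moments_def\<close>)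

lemma all_moments_mult:
  assumes f: "all_moments M f" and g: "all_moments M g"
  shows "all_moments M (\<lambda>\<omega>. f \<omega> * g \<omega>)"
  unfolding all_moments_def
proof (intro conjI allI)
  \<comment> \<open>The moments of order \<open>2 * n\<close> make the \<open>n\<close>-th powers
    square-integrable, and a product of two square-integrable functions is integrable.\<close>
  have sq: "square_integrable M (\<lambda>\<omega>. \<bar>h \<omega>\<bar> ^ n)" if "all_moments M h" for h n
    using that all_moments_measurable[OF that]
    by (simp add: all_moments_def square_integrable_def power_mult[symmetric])
  show "integrable M (\<lambda>\<omega>. \<bar>f \<omega> * g \<omega>\<bar> ^ n)" for n
    using square_integrable_mult[OF sq[OF f] sq[OF g], of n n] by (simp add: abs_mult power_mult_distrib)
qed (intro borel_measurable_times all_moments_measurable f g)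

lemma all_moments_minus: "all_moments M f \<Longrightarrow> all_moments M (\<lambda>\<omega>. - f \<omega>)"
  by (auto simp: all_moments_def)

lemma all_moments_abs: "all_moments M f \<Longrightarrow> all_moments M (\<lambda>\<omega>. \<bar>f \<omega>\<bar>)"
  by (auto simp: all_moments_def)

lemma all_moments_add:
  assumes f: "all_moments M f" and g: "all_moments M g"
  shows "all_moments M (\<lambda>\<omega>. f \<omega> + g \<omega>)"
  unfolding all_moments_def
proof (intro conjI allI)
  show m: "(\<lambda>\<omega>. f \<omega> + g \<omega>) \<in> borel_measurable M"
    by (intro borel_measurable_add all_moments_measurable f g)
  fix n
  have "\<bar>a + b\<bar> ^ n \<le> 2 ^ n * (\<bar>a\<bar> ^ n + \<bar>b\<bar> ^ n)" for a b :: real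
  proof -
    have "\<bar>a + b\<bar> ^ n \<le> (2 * max \<bar>a\<bar> \<bar>b\<bar>) ^ n" by (intro power_mono) auto
    also have "\<dots> \<le> 2 ^ n * (\<bar>a\<bar> ^ n + \<bar>b\<bar> ^ n)" by (auto simp: power_mult_distrib max_def)
    finally show ?thesis .
  qed
  then have "AE \<omega> in M. norm (\<bar>f \<omega> + g \<omega>\<bar> ^ n) \<le> norm (2 ^ n * (\<bar>f \<omega>\<bar> ^ n + \<bar>g \<omega>\<bar> ^ n))"
    by (auto simp: abs_mult)
  moreover have "integrable M (\<lambda>\<omega>. 2 ^ n * (\<bar>f \<omega>\<bar> ^ n + \<bar>g \<omega>\<bar> ^ n))"
    using f g by (simp add: all_moments_def)
  moreover have "(\<lambda>\<omega>. \<bar>f \<omega> + g \<omega>\<bar> ^ n) \<in> borel_measurable M"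
    using m by (intro borel_measurable_power borel_measurable_abs)
  ultimately show "integrable M (\<lambda>\<omega>. \<bar>f \<omega> + g \<omega>\<bar> ^ n)"
    using Bochner_Integration.integrable_bound by blast
qed

lemma all_moments_diff:
  "all_moments M f \<Longrightarrow> all_moments M g \<Longrightarrow> all_moments M (\<lambda>\<omega>. f \<omega> - g \<omega>)"
  using all_moments_add[of M f "\<lambda>\<omega>. - g \<omega>"] all_moments_minus[of M g] by simp

lemma (in prob_space) all_moments_const: "all_moments M (\<lambda>\<omega>. c)"
  by (simp add: all_moments_def)

lemma (in prob_space) all_moments_sum:
  assumes "\<And>i. i \<in> I \<Longrightarrow> all_moments M (f i)"
  shows "all_moments M (\<lambda>\<omega>. \<Sum>i\<in>I. f i \<omega>)"
proof (cases "finite I")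
  case True
  then show ?thesis using assms
    by (induction I rule: finite_induct) (auto intro: all_moments_add all_moments_const)
qed (simp add: all_moments_const)

lemma (in prob_space) all_moments_prod:
  assumes "\<And>i. i \<in> I \<Longrightarrow> all_moments M (f i)"
  shows "all_moments M (\<lambda>\<omega>. \<Prod>i\<in>I. f i \<omega>)"
proof (cases "finite I")
  case True
  then show ?thesis using assms
    by (induction I rule: finite_induct) (auto intro: all_moments_mult all_moments_const)
qed (simp add: all_moments_const)

lemma (in prob_space) all_moments_power:
  "all_moments M f \<Longrightarrow> all_moments M (\<lambda>\<omega>. f \<omega> ^ n)"
  by (induction n) (auto intro: all_moments_mult all_moments_const)

lemma all_moments_cong:
  "(\<And>\<omega>. \<omega> \<in> space M \<Longrightarrow> f \<omega> = g \<omega>) \<Longrightarrow> all_moments M f \<longleftrightarrow> all_moments M g"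
  unfolding all_moments_def by (simp cong: measurable_cong Bochner_Integration.integrable_cong)

section \<open>Finite moments of the random vector and of the basis functions\<close>

context gpc_basis
begin

lemma basis_coefficient:
  assumes "finite S" "k \<in> S"
  shows "l2_inner M (\<lambda>\<omega>. \<Sum>i\<in>S. b i * \<Phi> i \<omega>) (\<Phi> k) = b k"
  using l2_inner_diff_span(1)[of S "\<lambda>_. 0" k "\<lambda>i. - b i"] assms by (simp add: l2_inner_def sum_negf)

text \<open>Testing against \<open>\<Phi> k\<close> isolates the coefficient. The almost-everywhere
  form is needed because pathwise relations hold only off a null set.\<close>

lemma basis_independent_AE:
  assumes "finite S" "AE \<omega> in M. (\<Sum>i\<in>S. b i * \<Phi> i \<omega>) = 0" "k \<in> S"
  shows "b k = 0"
proof -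
  have "l2_inner M (\<lambda>\<omega>. \<Sum>i\<in>S. b i * \<Phi> i \<omega>) (\<Phi> k) = 0"
    unfolding l2_inner_def by (rule integral_eq_zero_AE) (use assms(2) in eventually_elim, simp)
  then show ?thesis using basis_coefficient[OF assms(1,3)] by simp
qed

lemma finite_mdeg_le: "finite {j :: 'd \<Rightarrow> nat. mdeg j \<le> n}"
  using finite_resolved[of n] by (simp add: resolved_def)

text \<open>The \<open>\<Phi> i\<close> with \<open>mdeg i \<le> n\<close> are independent and as numerous as the monomials of degree
  at most \<open>n\<close>, so they span the same space.\<close>

lemma monomial_in_span:
  obtains d where "\<And>\<omega>. \<omega> \<in> space M \<Longrightarrow>
    (\<Prod>k\<in>UNIV. (\<xi> \<omega> $ k) ^ j k) = (\<Sum>i | mdeg i \<le> mdeg j. d i * \<Phi> i \<omega>)"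
proof -
  define m where "m = (\<lambda>(j::'d \<Rightarrow> nat) \<omega>. \<Prod>k\<in>UNIV. (\<xi> \<omega> $ k) ^ j k)"
  let ?J = "{i :: 'd \<Rightarrow> nat. mdeg i \<le> mdeg j}"
  have "\<exists>c. \<forall>\<omega>\<in>space M. \<Phi> i \<omega> = (\<Sum>j\<in>?J. c j * m j \<omega>)" if i: "i \<in> ?J" for i
  proof -
    obtain p where p: "poly_of_degree (mdeg i) p" "\<forall>\<omega>\<in>space M. \<Phi> i \<omega> = p (\<xi> \<omega>)"
      using polynomial by blast
    then obtain c where c: "\<And>\<omega>. \<omega> \<in> space M \<Longrightarrow> \<Phi> i \<omega> = (\<Sum>j | mdeg j \<le> mdeg i. c j * m j \<omega>)"
      unfolding poly_of_degree_def m_def by blast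
    \<comment> \<open>Padding with zeros brings all expansions to the common index set
      \<open>?J\<close>, so that the coefficient matrix is square.\<close>
    have "(\<Sum>j | mdeg j \<le> mdeg i. c j * m j \<omega>)
        = (\<Sum>j\<in>?J. (if mdeg j \<le> mdeg i then c j else 0) * m j \<omega>)" for \<omega>
      using i by (intro sum.mono_neutral_cong_left finite_mdeg_le) auto
    then show ?thesis using c by (intro exI[of _ "\<lambda>j. if mdeg j \<le> mdeg i then c j else 0"]) auto
  qed
  then have "\<exists>C. \<forall>i\<in>?J. \<forall>\<omega>\<in>space M. \<Phi> i \<omega> = (\<Sum>j\<in>?J. C i j * m j \<omega>)"
    by (intro bchoice ballI)
  then obtain C where C: "\<And>i \<omega>. i \<in> ?J \<Longrightarrow> \<omega> \<in> space M \<Longrightarrow> \<Phi> i \<omega> = (\<Sum>j\<in>?J. C i j * m j \<omega>)"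
    by (elim exE) blast
  have comb: "(\<Sum>i\<in>?J. b i * \<Phi> i \<omega>) = (\<Sum>j\<in>?J. (\<Sum>i\<in>?J. b i * C i j) * m j \<omega>)"
    if "\<omega> \<in> space M" for b \<omega>
  proof -
    have "(\<Sum>i\<in>?J. b i * \<Phi> i \<omega>) = (\<Sum>i\<in>?J. \<Sum>j\<in>?J. b i * C i j * m j \<omega>)"
      using C that by (intro sum.cong) (auto simp: sum_distrib_left mult.assoc)
    also have "\<dots> = (\<Sum>j\<in>?J. \<Sum>i\<in>?J. b i * C i j * m j \<omega>)" by (rule sum.swap)
    finally show ?thesis by (simp add: sum_distrib_right)
  qed
  \<comment> \<open>A left kernel vector of \<open>C\<close> yields a combination of the
    \<open>\<Phi> i\<close> that vanishes on the whole space, so it is zero. The right-hand side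
    selects the monomial with exponent \<open>j\<close>.\<close>
  obtain d where d: "\<forall>j'\<in>?J. (\<Sum>i\<in>?J. d i * C i j') = (if j' = j then 1 else 0)"
  proof (rule exE[OF square_system_solvable[OF finite_mdeg_le, of "mdeg j" C]])
    fix b i assume b: "\<And>j'. j' \<in> ?J \<Longrightarrow> (\<Sum>i\<in>?J. b i * C i j') = 0" and i: "i \<in> ?J"
    have "(\<Sum>i\<in>?J. b i * \<Phi> i \<omega>) = 0" if "\<omega> \<in> space M" for \<omega>
      unfolding comb[OF that] using b by (intro sum.neutral) simp
    then show "b i = 0" using i by (intro basis_independent_AE[OF finite_mdeg_le]) auto
  qed
  have "m j \<omega> = (\<Sum>i\<in>?J. d i * \<Phi> i \<omega>)" if \<omega>: "\<omega> \<in> space M" for \<omega>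
  proof -
    have "(\<Sum>j'\<in>?J. (\<Sum>i\<in>?J. d i * C i j') * m j' \<omega>) = (\<Sum>j'\<in>?J. if j' = j then m j' \<omega> else 0)"
      using d by (intro sum.cong) auto
    also have "\<dots> = m j \<omega>" using finite_mdeg_le by simp
    finally show ?thesis using comb[OF \<omega>, of d] by simp
  qed
  then show thesis using that unfolding m_def by blast
qed

text \<open>Each power of a component is a monomial, hence a finite combination of square-integrable
  basis functions, and on a probability space such a function is integrable.\<close>

lemma all_moments_component: "all_moments M (\<lambda>\<omega>. \<xi> \<omega> $ k)"
  unfolding all_moments_def
proof (intro conjI allI)
  show meas: "(\<lambda>\<omega>. \<xi> \<omega> $ k) \<in> borel_measurable M"
    using random_vector by (rule measurable_compose)
      (intro borel_measurable_continuous_onI continuous_intros)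
  fix n
  define j :: "'d \<Rightarrow> nat" where "j = (\<lambda>l. if l = k then n else 0)"
  obtain d where d: "\<And>\<omega>. \<omega> \<in> space M \<Longrightarrow>
    (\<Prod>l\<in>UNIV. (\<xi> \<omega> $ l) ^ j l) = (\<Sum>i | mdeg i \<le> mdeg j. d i * \<Phi> i \<omega>)"
    using monomial_in_span by blast
  have "(\<Prod>l\<in>UNIV. (\<xi> \<omega> $ l) ^ j l) = (\<xi> \<omega> $ k) ^ n" for \<omega>
  proof -
    have "(\<Prod>l\<in>UNIV. (\<xi> \<omega> $ l) ^ j l) = (\<Prod>l\<in>UNIV. if l = k then (\<xi> \<omega> $ l) ^ n else 1)"
      by (intro prod.cong) (auto simp: j_def)
    then show ?thesis by simp
  qed
  with d have eq: "\<And>\<omega>. \<omega> \<in> space M \<Longrightarrow> (\<xi> \<omega> $ k) ^ n = (\<Sum>i | mdeg i \<le> mdeg j. d i * \<Phi> i \<omega>)"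
    by simp
  have "square_integrable M (\<lambda>\<omega>. \<Sum>i | mdeg i \<le> mdeg j. d i * \<Phi> i \<omega>)"
    by (intro square_integrable_sum square_integrable_cmult square_integrable_basis)
  moreover have "square_integrable M (\<lambda>_. 1)" by (simp add: square_integrable_def)
  ultimately have "integrable M (\<lambda>\<omega>. (\<Sum>i | mdeg i \<le> mdeg j. d i * \<Phi> i \<omega>) * 1)"
    by (rule square_integrable_mult)
  then have "integrable M (\<lambda>\<omega>. (\<xi> \<omega> $ k) ^ n)"
    using eq by (simp cong: Bochner_Integration.integrable_cong)
  then show "integrable M (\<lambda>\<omega>. \<bar>\<xi> \<omega> $ k\<bar> ^ n)"
    by (simp add: power_abs[symmetric])
qed

text \<open>Orthonormality alone provides second moments. As polynomials in components with all
  moments, the basis functions gain moments of every order.\<close>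

lemma all_moments_basis: "all_moments M (\<Phi> i)"
proof -
  obtain p where p: "poly_of_degree (mdeg i) p" "\<forall>\<omega>\<in>space M. \<Phi> i \<omega> = p (\<xi> \<omega>)"
    using polynomial by blast
  then obtain c where "\<And>\<omega>. \<omega> \<in> space M \<Longrightarrow>
      \<Phi> i \<omega> = (\<Sum>j | mdeg j \<le> mdeg i. c j * (\<Prod>k\<in>UNIV. (\<xi> \<omega> $ k) ^ j k))"
    unfolding poly_of_degree_def by blast
  then show ?thesis
    by (subst all_moments_cong, assumption)
      (intro all_moments_sum all_moments_mult all_moments_const all_moments_prod
        all_moments_power all_moments_component)
qed

end

section \<open>Projection onto finitely many modes\<close>

locale gpc_truncation = gpc_basis M \<xi> \<Phi>
  for M :: "'a measure" and \<xi> :: "'a \<Rightarrow> real ^ 'd::finite" and \<Phi> :: "('d \<Rightarrow> nat) \<Rightarrow> 'a \<Rightarrow> real" +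
  fixes S :: "('d \<Rightarrow> nat) set"
  assumes finite_S: "finite S"
begin

abbreviation V :: "('a \<Rightarrow> real) set" where "V \<equiv> gpc_span \<Phi> S"
abbreviation Proj :: "('a \<Rightarrow> real) \<Rightarrow> 'a \<Rightarrow> real" where "Proj \<equiv> orth_proj M V"
abbreviation Compl :: "('a \<Rightarrow> real) \<Rightarrow> 'a \<Rightarrow> real" where "Compl \<equiv> compl_proj Proj"

definition envelope :: "'a \<Rightarrow> real" where
  "envelope \<omega> = (\<Sum>k\<in>S. \<bar>\<Phi> k \<omega>\<bar>)"

text \<open>Products of the true solution are not assumed square-integrable, only integrable against
  the resolved basis functions. That is enough for the coefficient formula of the
  projection.\<close>

definition projectable :: "('a \<Rightarrow> real) \<Rightarrow> bool" where
  "projectable f \<longleftrightarrow> (\<forall>k\<in>S. integrable M (\<lambda>\<omega>. f \<omega> * \<Phi> k \<omega>))"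

lemma envelope_nonneg: "0 \<le> envelope \<omega>"
  by (simp add: envelope_def sum_nonneg)

lemma all_moments_envelope: "all_moments M envelope"
  unfolding envelope_def by (intro all_moments_sum all_moments_abs all_moments_basis)

lemma square_integrable_projectable: "square_integrable M f \<Longrightarrow> projectable f"
  unfolding projectable_def by (blast intro: square_integrable_mult square_integrable_basis)

lemma projectable_cmult: "projectable f \<Longrightarrow> projectable (\<lambda>\<omega>. c * f \<omega>)"
  by (auto simp: projectable_def mult.assoc)

lemma projectable_add: "projectable f \<Longrightarrow> projectable g \<Longrightarrow> projectable (\<lambda>\<omega>. f \<omega> + g \<omega>)"
  by (auto simp: projectable_def distrib_right)

lemma Proj_eq: "projectable f \<Longrightarrow> Proj f = (\<lambda>\<omega>. \<Sum>k\<in>S. l2_inner M f (\<Phi> k) * \<Phi> k \<omega>)"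
  by (rule orth_proj_eq[OF finite_S]) (simp add: projectable_def)

lemma Proj_in_span: "projectable f \<Longrightarrow> Proj f \<in> V"
  unfolding gpc_span_def by (intro CollectI exI[of _ "\<lambda>k. l2_inner M f (\<Phi> k)"]) (simp add: Proj_eq flip: gpc_span_def)

lemma span_expansion: "g \<in> V \<Longrightarrow> g = (\<lambda>\<omega>. \<Sum>k\<in>S. l2_inner M g (\<Phi> k) * \<Phi> k \<omega>)"
  by (auto simp: gpc_span_def basis_coefficient[OF finite_S] cong: sum.cong)

lemma span_diff: "f \<in> V \<Longrightarrow> g \<in> V \<Longrightarrow> (\<lambda>\<omega>. f \<omega> - g \<omega>) \<in> V"
  by (auto simp: gpc_span_def simp flip: sum_subtractf left_diff_distrib)

lemma all_moments_span: "g \<in> V \<Longrightarrow> all_moments M g"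
  by (subst span_expansion, assumption)
    (intro all_moments_sum all_moments_mult all_moments_const all_moments_basis)

lemma square_integrable_span: "g \<in> V \<Longrightarrow> square_integrable M g"
  by (intro all_moments_square_integrable all_moments_span)

lemma integrable_mult_span:
  assumes "projectable f" "g \<in> V"
  shows "integrable M (\<lambda>\<omega>. f \<omega> * g \<omega>)"
proof -
  have "(\<lambda>\<omega>. f \<omega> * g \<omega>) = (\<lambda>\<omega>. \<Sum>k\<in>S. l2_inner M g (\<Phi> k) * (f \<omega> * \<Phi> k \<omega>))"
    by (subst span_expansion[OF assms(2)]) (auto simp: sum_distrib_left algebra_simps)
  then show ?thesis using assms(1) by (auto simp: projectable_def)
qed

text \<open>Parseval's identity in a form where only \<open>g\<close> has to be resolved; it
  converts derivatives of coefficient sums back into inner products.\<close>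

lemma l2_inner_span:
  assumes "projectable f" "g \<in> V"
  shows "l2_inner M f g = (\<Sum>k\<in>S. l2_inner M f (\<Phi> k) * l2_inner M g (\<Phi> k))"
proof -
  have "(\<lambda>\<omega>. f \<omega> * g \<omega>) = (\<lambda>\<omega>. \<Sum>k\<in>S. l2_inner M g (\<Phi> k) * (f \<omega> * \<Phi> k \<omega>))"
    by (subst span_expansion[OF assms(2)]) (auto simp: sum_distrib_left algebra_simps)
  then show ?thesis using assms(1)
    by (simp add: l2_inner_def[of M f] projectable_def mult.commute)
qed

lemma l2_norm_span: "g \<in> V \<Longrightarrow> (l2_norm M g)\<^sup>2 = (\<Sum>k\<in>S. (l2_inner M g (\<Phi> k))\<^sup>2)"
  using l2_inner_span[of g g] square_integrable_projectable[OF square_integrable_span, of g]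
  by (simp add: l2_norm_sq power2_eq_square[of "l2_inner _ _ _"])

text \<open>The \<open>\<Phi> k\<close> are unit vectors, so each coefficient is at most the norm.
  Finite dimension thus turns a mean-square bound into a pointwise one.\<close>

lemma span_le_envelope:
  assumes "g \<in> V"
  shows "\<bar>g \<omega>\<bar> \<le> l2_norm M g * envelope \<omega>"
proof -
  have "\<bar>l2_inner M g (\<Phi> k)\<bar> \<le> l2_norm M g" if "k \<in> S" for k
    using Cauchy_Schwarz_l2[OF square_integrable_span[OF assms] square_integrable_basis, of k]
      orthonormal[of k k] by (simp add: l2_norm_def[of M "\<Phi> k"])
  then have "(\<Sum>k\<in>S. \<bar>l2_inner M g (\<Phi> k)\<bar> * \<bar>\<Phi> k \<omega>\<bar>) \<le> (\<Sum>k\<in>S. l2_norm M g * \<bar>\<Phi> k \<omega>\<bar>)"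
    by (intro sum_mono mult_right_mono) auto
  moreover have "\<bar>g \<omega>\<bar> \<le> (\<Sum>k\<in>S. \<bar>l2_inner M g (\<Phi> k)\<bar> * \<bar>\<Phi> k \<omega>\<bar>)"
    by (subst span_expansion[OF assms]) (auto simp flip: abs_mult intro: sum_abs)
  ultimately show ?thesis by (simp add: envelope_def sum_distrib_left)
qed

lemma l2_inner_Proj:
  assumes "projectable f" "k \<in> S"
  shows "l2_inner M (Proj f) (\<Phi> k) = l2_inner M f (\<Phi> k)"
  using assms by (simp add: Proj_eq basis_coefficient[OF finite_S])

lemma Proj_add:
  assumes "projectable f" "projectable g"
  shows "Proj (\<lambda>\<omega>. f \<omega> + g \<omega>) = (\<lambda>\<omega>. Proj f \<omega> + Proj g \<omega>)"
proof -
  have "l2_inner M (\<lambda>\<omega>. f \<omega> + g \<omega>) (\<Phi> k) = l2_inner M f (\<Phi> k) + l2_inner M g (\<Phi> k)" if "k \<in> S" for k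
    using assms that by (simp add: l2_inner_def distrib_right projectable_def)
  then show ?thesis
    using assms by (simp add: Proj_eq projectable_add distrib_right sum.distrib)
qed

lemma square_integrable_Compl:
  "square_integrable M f \<Longrightarrow> square_integrable M (Compl f)"
  unfolding compl_proj_def
  using square_integrable_diff square_integrable_span Proj_in_span square_integrable_projectable by blast

lemma all_moments_Compl: "all_moments M f \<Longrightarrow> all_moments M (Compl f)"
  unfolding compl_proj_def
  using all_moments_diff all_moments_span Proj_in_span square_integrable_projectable
      all_moments_square_integrable by blast

lemma l2_inner_Compl_span:
  assumes f: "square_integrable M f" and g: "g \<in> V"
  shows "l2_inner M (Compl f) g = 0"
proof -
  have "l2_inner M (Compl f) (\<Phi> k) = 0" if "k \<in> S" for k
    using l2_inner_diff_span(1)[of S f k] square_integrable_projectable[OF f] that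
    by (simp add: compl_proj_def Proj_eq finite_S projectable_def)
  then show ?thesis
    using l2_inner_span[OF square_integrable_projectable[OF square_integrable_Compl[OF f]] g] by simp
qed

text \<open>The two sides differ by the pairing of \<open>Compl f\<close> with
  \<open>Proj g\<close>, which vanishes. Moving the complement between the factors is what reveals
  the dissipation of the memory terms.\<close>

lemma l2_inner_Compl:
  assumes f: "square_integrable M f" and g: "square_integrable M g"
  shows "l2_inner M (Compl f) (Compl g) = l2_inner M (Compl f) g"
proof -
  have "l2_inner M (Compl f) (Compl g) = l2_inner M (Compl f) g - l2_inner M (Compl f) (Proj g)"
    using square_integrable_mult[OF square_integrable_Compl[OF f]] g
      square_integrable_span[OF Proj_in_span[OF square_integrable_projectable[OF g]]]
    by (simp add: l2_inner_def compl_proj_def[of _ g] right_diff_distrib)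
  then show ?thesis
    using l2_inner_Compl_span[OF f Proj_in_span] square_integrable_projectable[OF g] by simp
qed

lemma Pythagoras:
  assumes f: "square_integrable M f"
  shows "(l2_norm M f)\<^sup>2 = (l2_norm M (Proj f))\<^sup>2 + (l2_norm M (Compl f))\<^sup>2"
proof -
  let ?p = "Proj f" and ?q = "Compl f"
  have p: "?p \<in> V" using f by (intro Proj_in_span square_integrable_projectable)
  have i: "integrable M (\<lambda>\<omega>. ?p \<omega> * ?p \<omega>)" "integrable M (\<lambda>\<omega>. ?q \<omega> * ?p \<omega>)" "integrable M (\<lambda>\<omega>. ?q \<omega> * ?q \<omega>)"
    using square_integrable_span[OF p] square_integrable_Compl[OF f] by (auto intro: square_integrable_mult)
  have "(\<lambda>\<omega>. f \<omega> * f \<omega>) = (\<lambda>\<omega>. ?p \<omega> * ?p \<omega> + 2 * (?q \<omega> * ?p \<omega>) + ?q \<omega> * ?q \<omega>)"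
    by (auto simp: compl_proj_def algebra_simps)
  then have "l2_inner M f f = l2_inner M ?p ?p + 2 * l2_inner M ?q ?p + l2_inner M ?q ?q"
    using i by (simp add: l2_inner_def)
  then show ?thesis using l2_inner_Compl_span[OF f p] by (simp add: l2_norm_sq)
qed

lemma l2_norm_Proj_le:
  assumes "square_integrable M f"
  shows "l2_norm M (Proj f) \<le> l2_norm M f"
  by (rule power2_le_imp_le[OF _ l2_norm_nonneg]) (simp add: Pythagoras[OF assms])

lemma l2_norm_Compl_le:
  assumes "square_integrable M f"
  shows "l2_norm M (Compl f) \<le> l2_norm M f"
  by (rule power2_le_imp_le[OF _ l2_norm_nonneg]) (simp add: Pythagoras[OF assms])

lemma Compl_add:
  assumes "projectable f" "projectable g"
  shows "Compl (\<lambda>\<omega>. f \<omega> + g \<omega>) = (\<lambda>\<omega>. Compl f \<omega> + Compl g \<omega>)"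
  by (simp add: compl_proj_def Proj_add[OF assms] algebra_simps fun_eq_iff)

text \<open>Takes the place of the Cauchy-Schwarz inequality when \<open>f\<close> is merely
  projectable: the resolved factor is bounded pointwise, leaving a mean of
  \<open>\<bar>f\<bar>\<close> weighted by the envelope.\<close>

lemma l2_inner_le_envelope:
  assumes "g \<in> V" "projectable f" "integrable M (\<lambda>\<omega>. envelope \<omega> * \<bar>f \<omega>\<bar>)"
  shows "\<bar>l2_inner M f g\<bar> \<le> l2_norm M g * (LINT \<omega>|M. envelope \<omega> * \<bar>f \<omega>\<bar>)"
proof -
  have "\<bar>l2_inner M f g\<bar> \<le> (LINT \<omega>|M. \<bar>f \<omega> * g \<omega>\<bar>)"
    unfolding l2_inner_def by (rule integral_abs_bound)
  also have "\<dots> \<le> (LINT \<omega>|M. l2_norm M g * (envelope \<omega> * \<bar>f \<omega>\<bar>))"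
  proof (rule integral_mono)
    show "integrable M (\<lambda>\<omega>. \<bar>f \<omega> * g \<omega>\<bar>)" using integrable_mult_span[OF assms(2,1)] by simp
    show "integrable M (\<lambda>\<omega>. l2_norm M g * (envelope \<omega> * \<bar>f \<omega>\<bar>))" using assms(3) by simp
    show "\<bar>f \<omega> * g \<omega>\<bar> \<le> l2_norm M g * (envelope \<omega> * \<bar>f \<omega>\<bar>)" for \<omega>
      using mult_right_mono[OF span_le_envelope[OF assms(1), of \<omega>], of "\<bar>f \<omega>\<bar>"]
      by (simp add: abs_mult ac_simps)
  qed
  finally show ?thesis by simp
qed

end

section \<open>Energy dissipation in the t-model\<close>

lemma nonincreasing_from_0:
  fixes f f' :: "real \<Rightarrow> real"
  assumes deriv: "\<And>s. 0 \<le> s \<Longrightarrow> (f has_real_derivative f' s) (at s within {0..})"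
    and neg: "\<And>s. 0 \<le> s \<Longrightarrow> f' s \<le> 0" and t: "0 \<le> t"
  shows "f t \<le> f 0"
proof (cases "t = 0")
  case False
  with t have t: "0 < t" by simp
  have "\<exists>s\<in>{0<..<t}. f t - f 0 = f' s * (t - 0)"
  proof (rule mvt_simple[OF t])
    fix s assume "0 \<le> s" "s \<le> t"
    then show "(f has_derivative (*) (f' s)) (at s within {0..t})"
      using deriv[of s] by (auto simp: has_field_derivative_def intro: has_derivative_subset)
  qed
  then obtain s where s: "0 < s" "f t - f 0 = f' s * t" by auto
  have "f' s * t \<le> 0" using neg[of s] s t by (simp add: mult_nonpos_nonneg)
  then show ?thesis using s by simp
qed simp

definition ko_rhs :: "(3 \<Rightarrow> 'a \<Rightarrow> real) \<Rightarrow> 3 \<Rightarrow> 'a \<Rightarrow> real" where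
  "ko_rhs u i = (if i = 1 then prodB (u 1) (u 3)
     else if i = 2 then (\<lambda>\<omega>. - prodB (u 2) (u 3) \<omega>)
     else (\<lambda>\<omega>. - prodB (u 1) (u 1) \<omega> + prodB (u 2) (u 2) \<omega>))"

section \<open>The memory terms of the t-model\<close>

context gpc_truncation
begin

lemma projectable_minus: "projectable f \<Longrightarrow> projectable (\<lambda>\<omega>. - f \<omega>)"
  using projectable_cmult[of f "-1"] by simp

lemma projectable_lincomb:
  "projectable f \<Longrightarrow> projectable g \<Longrightarrow> projectable (\<lambda>\<omega>. f \<omega> + c * g \<omega>)"
  by (intro projectable_add projectable_cmult)

lemma l2_inner_lincomb:
  assumes "projectable f" "projectable g" "h \<in> V"
  shows "l2_inner M (\<lambda>\<omega>. f \<omega> + c * g \<omega>) h = l2_inner M f h + c * l2_inner M g h"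
  using integrable_mult_span[OF assms(1,3)] integrable_mult_span[OF assms(2,3)]
  by (simp add: l2_inner_def distrib_right mult.assoc)

lemma Proj_lincomb:
  assumes "projectable f" "projectable g"
  shows "Proj (\<lambda>\<omega>. f \<omega> + c * g \<omega>) = (\<lambda>\<omega>. Proj f \<omega> + c * Proj g \<omega>)"
proof -
  have "l2_inner M (\<lambda>\<omega>. f \<omega> + c * g \<omega>) (\<Phi> k) = l2_inner M f (\<Phi> k) + c * l2_inner M g (\<Phi> k)" if "k \<in> S" for k
    using assms that by (simp add: l2_inner_def distrib_right projectable_def mult.assoc)
  then show ?thesis
    using assms
    by (simp add: Proj_eq projectable_lincomb distrib_right sum.distrib sum_distrib_left mult.assoc)
qed

definition cubic :: "(3 \<Rightarrow> 'a \<Rightarrow> real) \<Rightarrow> 3 \<Rightarrow> 3 \<Rightarrow> 3 \<Rightarrow> 'a \<Rightarrow> real" where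
  "cubic u m i j = prodB (u m) (Compl (prodB (u i) (u j)))"

text \<open>The factor of \<open>t\<close> in the t-model before projection, with
  \<open>\<Gamma>\<^sub>1\<close>, \<open>\<Gamma>\<^sub>2\<close>, \<open>\<Gamma>\<^sub>3\<close>
  inserted and signs collected. Explicit scalars, even 1, keep the shape \<open>f + c * g\<close> of
  the linearity rules.\<close>

definition memory :: "(3 \<Rightarrow> 'a \<Rightarrow> real) \<Rightarrow> 3 \<Rightarrow> 'a \<Rightarrow> real" where
  "memory u i = (if i = 1 then (\<lambda>\<omega>. (cubic u 3 1 3 \<omega> + (-1) * cubic u 1 1 1 \<omega>) + 1 * cubic u 1 2 2 \<omega>)
     else if i = 2 then (\<lambda>\<omega>. (cubic u 3 2 3 \<omega> + 1 * cubic u 2 1 1 \<omega>) + (-1) * cubic u 2 2 2 \<omega>)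
     else (\<lambda>\<omega>. (-2) * cubic u 1 1 3 \<omega> + (-2) * cubic u 2 2 3 \<omega>))"

text \<open>The projection is left out on purpose: paired with a resolved function, the right-hand
  side and its projection give the same value.\<close>

definition t_rhs :: "real \<Rightarrow> (3 \<Rightarrow> 'a \<Rightarrow> real) \<Rightarrow> 3 \<Rightarrow> 'a \<Rightarrow> real" where
  "t_rhs t u i = (\<lambda>\<omega>. ko_rhs u i \<omega> + t * memory u i \<omega>)"

lemma all_moments_prodB: "all_moments M f \<Longrightarrow> all_moments M g \<Longrightarrow> all_moments M (prodB f g)"
  unfolding prodB_def by (rule all_moments_mult)

lemma all_moments_projectable: "all_moments M f \<Longrightarrow> projectable f"
  by (intro square_integrable_projectable all_moments_square_integrable)

context
  fixes u :: "3 \<Rightarrow> 'a \<Rightarrow> real"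
  assumes u: "\<And>i. u i \<in> V"
begin

lemma all_moments_pair: "all_moments M (prodB (u i) (u j))"
  by (intro all_moments_prodB all_moments_span u)

lemma all_moments_cubic: "all_moments M (cubic u m i j)"
  unfolding cubic_def by (intro all_moments_prodB all_moments_Compl all_moments_span u)

lemmas projectable_pair = all_moments_projectable[OF all_moments_pair]
lemmas projectable_cubic = all_moments_projectable[OF all_moments_cubic]

lemma projectable_memory: "projectable (memory u i)"
  by (auto simp only: memory_def split: if_split
      intro!: projectable_add projectable_cmult projectable_cubic)

lemma projectable_ko_rhs_span: "projectable (ko_rhs u i)"
  by (auto simp only: ko_rhs_def split: if_split
      intro!: projectable_add projectable_minus projectable_pair)

lemma projectable_t_rhs: "projectable (t_rhs t u i)"
  unfolding t_rhs_def by (intro projectable_lincomb projectable_memory projectable_ko_rhs_span)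

text \<open>Linearity of the projection after expanding the Gammas; the two equal products in each
  brace of the third equation account for the factors 2.\<close>

lemma Proj_t_rhs:
  "Proj (t_rhs t u 1) \<omega> = t_model_rhs1 Proj t u \<omega>"
  "Proj (t_rhs t u 2) \<omega> = t_model_rhs2 Proj t u \<omega>"
  "Proj (t_rhs t u 3) \<omega> = t_model_rhs3 Proj t u \<omega>"
proof -
  have G1: "prodB (Gamma1 Proj u) (u m) = cubic u m 1 3" for m
    by (simp add: Gamma1_def cubic_def prodB_def mult.commute)
  have G2: "prodB (Gamma2 Proj u) (u m) = (\<lambda>\<omega>. (-1) * cubic u m 2 3 \<omega>)" for m
    by (simp add: Gamma2_def cubic_def prodB_def mult.commute)
  have G3: "prodB (u m) (Gamma3 Proj u) = (\<lambda>\<omega>. (-1) * cubic u m 1 1 \<omega> + 1 * cubic u m 2 2 \<omega>)" for m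
    by (simp add: Gamma3_def cubic_def prodB_def algebra_simps)
  have comm: "prodB (u m) f = prodB f (u m)" for m f by (simp add: prodB_def mult.commute)
  \<comment> \<open>Homogeneity is read off from the linearity rule with the zero function, written
    as 0 times the cubic term, as first summand.\<close>
  have P1: "Proj (\<lambda>\<omega>. c * cubic u m i j \<omega>) = (\<lambda>\<omega>. c * Proj (cubic u m i j) \<omega>)" for c m i j
    using Proj_lincomb[OF projectable_cmult[OF projectable_cubic[of m i j], of 0] projectable_cubic[of m i j], of c]
      Proj_eq[OF projectable_cmult[OF projectable_cubic[of m i j], of 0]]
    by (simp add: l2_inner_def)
  have P2: "Proj (\<lambda>\<omega>. c * cubic u m i j \<omega> + d * cubic u m' i' j' \<omega>)
      = (\<lambda>\<omega>. c * Proj (cubic u m i j) \<omega> + d * Proj (cubic u m' i' j') \<omega>)" for c d m i j m' i' j'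
    by (subst Proj_lincomb[OF projectable_cmult[OF projectable_cubic] projectable_cubic]) (simp only: P1)
  have K3: "Proj (\<lambda>\<omega>. - prodB (u 1) (u 1) \<omega> + prodB (u 2) (u 2) \<omega>)
      = (\<lambda>\<omega>. - Proj (prodB (u 1) (u 1)) \<omega> + Proj (prodB (u 2) (u 2)) \<omega>)"
    using Proj_lincomb[OF projectable_pair[of 2 2] projectable_pair[of 1 1], of "-1"]
    by simp
  \<comment> \<open>The coefficient -2 expresses negation as \<open>f + (-2) * f\<close>, an
    instance of the linearity rule.\<close>
  have K2: "Proj (\<lambda>\<omega>. - prodB (u 2) (u 3) \<omega>) = (\<lambda>\<omega>. - Proj (prodB (u 2) (u 3)) \<omega>)"
    using Proj_lincomb[OF projectable_pair[of 2 3] projectable_pair[of 2 3], of "-2"] by simp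
  have M1: "Proj (memory u 1) = (\<lambda>\<omega>. (Proj (cubic u 3 1 3) \<omega> + (-1) * Proj (cubic u 1 1 1) \<omega>) + 1 * Proj (cubic u 1 2 2) \<omega>)"
    by (simp only: memory_def if_True simp_thms Proj_lincomb projectable_lincomb projectable_cubic)
  have M2: "Proj (memory u 2) = (\<lambda>\<omega>. (Proj (cubic u 3 2 3) \<omega> + 1 * Proj (cubic u 2 1 1) \<omega>) + (-1) * Proj (cubic u 2 2 2) \<omega>)"
    using Proj_lincomb[OF projectable_lincomb[OF projectable_cubic[of 3 2 3] projectable_cubic[of 2 1 1], of 1] projectable_cubic[of 2 2 2], of "-1"]
      Proj_lincomb[OF projectable_cubic[of 3 2 3] projectable_cubic[of 2 1 1], of 1]
    by (simp add: memory_def)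
  have M3: "Proj (memory u 3) = (\<lambda>\<omega>. (-2) * Proj (cubic u 1 1 3) \<omega> + (-2) * Proj (cubic u 2 2 3) \<omega>)"
    using P2[of "-2" 1 1 3 "-2" 2 2 3] by (simp add: memory_def)
  have T: "Proj (t_rhs t u i) = (\<lambda>\<omega>. Proj (ko_rhs u i) \<omega> + t * Proj (memory u i) \<omega>)" for i
    unfolding t_rhs_def by (rule Proj_lincomb[OF projectable_ko_rhs_span projectable_memory])
  show "Proj (t_rhs t u 1) \<omega> = t_model_rhs1 Proj t u \<omega>"
    unfolding t_model_rhs1_def T M1 G1 G3 P2 by (simp add: ko_rhs_def algebra_simps)
  show "Proj (t_rhs t u 2) \<omega> = t_model_rhs2 Proj t u \<omega>"
    unfolding t_model_rhs2_def T M2 G2 G3 P2 P1 by (simp add: ko_rhs_def K2 algebra_simps)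
  have G1': "prodB (u m) (Gamma1 Proj u) = cubic u m 1 3" for m
    using G1[of m] by (simp add: prodB_def mult.commute)
  have G2': "prodB (u m) (Gamma2 Proj u) = (\<lambda>\<omega>. (-1) * cubic u m 2 3 \<omega>)" for m
    using G2[of m] by (simp add: prodB_def mult.commute)
  have D1: "Proj (\<lambda>\<omega>. cubic u 1 1 3 \<omega> + cubic u 1 1 3 \<omega>) = (\<lambda>\<omega>. 2 * Proj (cubic u 1 1 3) \<omega>)"
    using P2[of 1 1 1 3 1 1 1 3] by simp
  show "Proj (t_rhs t u 3) \<omega> = t_model_rhs3 Proj t u \<omega>"
    unfolding t_model_rhs3_def T M3 G1 G2 G1' G2' D1 P2 by (simp add: ko_rhs_def K3[simplified] algebra_simps)
qed

lemma l2_inner_memory: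
  assumes "h \<in> V"
  shows "l2_inner M (memory u 1) h =
      l2_inner M (cubic u 3 1 3) h - l2_inner M (cubic u 1 1 1) h + l2_inner M (cubic u 1 2 2) h"
    and "l2_inner M (memory u 2) h =
      l2_inner M (cubic u 3 2 3) h + l2_inner M (cubic u 2 1 1) h - l2_inner M (cubic u 2 2 2) h"
    and "l2_inner M (memory u 3) h =
      - 2 * l2_inner M (cubic u 1 1 3) h - 2 * l2_inner M (cubic u 2 2 3) h"
proof -
  have i: "integrable M (\<lambda>\<omega>. cubic u m i j \<omega> * h \<omega>)" for m i j
    by (rule integrable_mult_span[OF projectable_cubic assms])
  show "l2_inner M (memory u 1) h =
      l2_inner M (cubic u 3 1 3) h - l2_inner M (cubic u 1 1 1) h + l2_inner M (cubic u 1 2 2) h"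
    using i by (simp add: memory_def l2_inner_def distrib_right left_diff_distrib)
  show "l2_inner M (memory u 2) h =
      l2_inner M (cubic u 3 2 3) h + l2_inner M (cubic u 2 1 1) h - l2_inner M (cubic u 2 2 2) h"
    using i by (simp add: memory_def l2_inner_def distrib_right left_diff_distrib)
  show "l2_inner M (memory u 3) h =
      - 2 * l2_inner M (cubic u 1 1 3) h - 2 * l2_inner M (cubic u 2 2 3) h"
    using i by (simp add: memory_def l2_inner_def distrib_right left_diff_distrib mult.assoc)
qed

lemma l2_inner_t_rhs:
  "h \<in> V \<Longrightarrow> l2_inner M (t_rhs t u i) h = l2_inner M (ko_rhs u i) h + t * l2_inner M (memory u i) h"
  unfolding t_rhs_def by (rule l2_inner_lincomb[OF projectable_ko_rhs_span projectable_memory])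

text \<open>The quadratic part conserves the energy, and the memory part dissipates it:
  the sum below equals \<open>- t (\<parallel>\<Gamma>\<^sub>1\<parallel>\<^sup>2 + \<parallel>\<Gamma>\<^sub>2\<parallel>\<^sup>2 + \<parallel>\<Gamma>\<^sub>3\<parallel>\<^sup>2)\<close>.\<close>

lemma t_rhs_dissipative:
  assumes t: "0 \<le> t"
  shows "(\<Sum>i\<in>UNIV. l2_inner M (t_rhs t u i) (u i)) \<le> 0"
proof -
  have int: "integrable M (\<lambda>\<omega>. u i \<omega> * u j \<omega> * u k \<omega>)" for i j k
    using integrable_mult_span[OF projectable_pair u, of i j k] by (simp add: prodB_def)
  \<comment> \<open>The means of \<open>u 1 * u 1 * u 3\<close> and of
    \<open>u 2 * u 2 * u 3\<close> each occur twice, with opposite signs.\<close>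
  have ko: "(\<Sum>i\<in>UNIV. l2_inner M (ko_rhs u i) (u i)) = 0"
  proof -
    have "l2_inner M (ko_rhs u 1) (u 1) = (LINT \<omega>|M. u 1 \<omega> * u 1 \<omega> * u 3 \<omega>)"
      "l2_inner M (ko_rhs u 2) (u 2) = - (LINT \<omega>|M. u 2 \<omega> * u 2 \<omega> * u 3 \<omega>)"
      by (simp_all add: l2_inner_def ko_rhs_def prodB_def ac_simps)
    moreover have "l2_inner M (ko_rhs u 3) (u 3)
        = - (LINT \<omega>|M. u 1 \<omega> * u 1 \<omega> * u 3 \<omega>) + (LINT \<omega>|M. u 2 \<omega> * u 2 \<omega> * u 3 \<omega>)"
      using int by (simp add: l2_inner_def ko_rhs_def prodB_def left_diff_distrib)
    ultimately show ?thesis by (simp add: sum_3)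
  qed
  define c where "c = (\<lambda>i j. Compl (prodB (u i) (u j)))"
  have sq: "square_integrable M (prodB (u i) (u j))" for i j
    by (rule all_moments_square_integrable[OF all_moments_pair])
  have csq: "square_integrable M (c i j)" for i j
    unfolding c_def by (rule square_integrable_Compl[OF sq])
  \<comment> \<open>The complement moves onto the product of \<open>u m\<close> and the test
    function \<open>u l\<close>, so each memory term pairs two unresolved products.\<close>
  have cubic: "l2_inner M (cubic u m i j) (u l) = l2_inner M (c i j) (c m l)" for m i j l
    using l2_inner_Compl[OF sq sq, of i j m l]
    by (simp add: cubic_def l2_inner_def c_def prodB_def[of _ "u _"] prodB_def[of "u _" "Compl _"] ac_simps)
  have sym: "c 3 1 = c 1 3" "c 3 2 = c 2 3"
    by (simp_all add: c_def prodB_def mult.commute)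
  have comm: "l2_inner M (c 2 2) (c 1 1) = l2_inner M (c 1 1) (c 2 2)"
    by (simp add: l2_inner_def mult.commute)
  have g3: "l2_inner M (\<lambda>\<omega>. c 1 1 \<omega> - c 2 2 \<omega>) (\<lambda>\<omega>. c 1 1 \<omega> - c 2 2 \<omega>)
      = l2_inner M (c 1 1) (c 1 1) - 2 * l2_inner M (c 1 1) (c 2 2) + l2_inner M (c 2 2) (c 2 2)"
  proof -
    have "(\<lambda>\<omega>. (c 1 1 \<omega> - c 2 2 \<omega>) * (c 1 1 \<omega> - c 2 2 \<omega>))
       = (\<lambda>\<omega>. c 1 1 \<omega> * c 1 1 \<omega> - 2 * (c 1 1 \<omega> * c 2 2 \<omega>) + c 2 2 \<omega> * c 2 2 \<omega>)"
      by (auto simp: algebra_simps)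
    then show ?thesis using square_integrable_mult[OF csq csq] by (simp add: l2_inner_def)
  qed
  \<comment> \<open>The first two components contribute the squares of \<open>c 1 3\<close> and
    \<open>c 2 3\<close> once, the third contributes them with factor -2; the diagonal terms
    complete a square.\<close>
  have "(\<Sum>i\<in>UNIV. l2_inner M (memory u i) (u i)) =
     - l2_inner M (c 1 3) (c 1 3) - l2_inner M (c 2 3) (c 2 3)
     - l2_inner M (\<lambda>\<omega>. c 1 1 \<omega> - c 2 2 \<omega>) (\<lambda>\<omega>. c 1 1 \<omega> - c 2 2 \<omega>)"
    unfolding sum_3 l2_inner_memory[OF u] cubic sym g3 comm by simp
  also have "\<dots> \<le> 0"
    using l2_norm_sq[of M "c 1 3"] l2_norm_sq[of M "c 2 3"]
      l2_norm_sq[of M "\<lambda>\<omega>. c 1 1 \<omega> - c 2 2 \<omega>"] by (smt (verit) zero_le_power2)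
  finally have "t * (\<Sum>i\<in>UNIV. l2_inner M (memory u i) (u i)) \<le> 0"
    using t by (simp add: mult_nonneg_nonpos)
  then show ?thesis
    using ko by (simp add: l2_inner_t_rhs[OF u] sum.distrib sum_distrib_left)
qed

end

end

section \<open>Evolution of the coefficients and a priori bounds\<close>

text \<open>\<open>initial_products\<close> concerns time 0 only; conservation of the radius carries
  it to all later times in \<open>projectable_products\<close>.\<close>

locale t_model_error = gpc_truncation M \<xi> \<Phi> S
  for M :: "'a measure" and \<xi> :: "'a \<Rightarrow> real ^ 'd::finite" and \<Phi> :: "('d \<Rightarrow> nat) \<Rightarrow> 'a \<Rightarrow> real"
    and S :: "('d \<Rightarrow> nat) set" +
  fixes y z :: "3 \<Rightarrow> real \<Rightarrow> 'a \<Rightarrow> real"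
  assumes second_order: "\<And>i t. t \<ge> 0 \<Longrightarrow> square_integrable M (y i t)"
    and initial_products:
      "\<And>i j k. k \<in> S \<Longrightarrow> integrable M (\<lambda>\<omega>. prodB (y i 0) (y j 0) \<omega> * \<Phi> k \<omega>)"
    and system: "kraichnan_orszag M y"
    and resolved_values: "\<And>i t. t \<ge> 0 \<Longrightarrow> z i t \<in> gpc_span \<Phi> S"
    and reduced: "t_model M (orth_proj M (gpc_span \<Phi> S)) z"
begin

section \<open>Pathwise conservation and its consequences\<close>

abbreviation Y :: "real \<Rightarrow> 3 \<Rightarrow> 'a \<Rightarrow> real" where "Y t \<equiv> \<lambda>i. y i t"
abbreviation Z :: "real \<Rightarrow> 3 \<Rightarrow> 'a \<Rightarrow> real" where "Z t \<equiv> \<lambda>i. z i t"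

text \<open>The radius of the sphere on which almost every path stays; it is a majorant of the true
  solution that does not depend on time.\<close>

definition radius :: "'a \<Rightarrow> real" where
  "radius \<omega> = sqrt (\<Sum>i\<in>UNIV. (y i 0 \<omega>)\<^sup>2)"

lemma radius_nonneg: "0 \<le> radius \<omega>"
  by (simp add: radius_def sum_nonneg)

lemma radius_sq: "(radius \<omega>)\<^sup>2 = (\<Sum>i\<in>UNIV. (y i 0 \<omega>)\<^sup>2)"
  by (simp add: radius_def sum_nonneg)

lemma square_integrable_radius: "square_integrable M radius"
  unfolding square_integrable_def
proof
  show "radius \<in> borel_measurable M"
    unfolding radius_def using second_order[of 0]
    by (intro measurable_compose[OF _ borel_measurable_sqrt] borel_measurable_sum borel_measurable_power
        square_integrable_measurable) simp
  show "integrable M (\<lambda>\<omega>. (radius \<omega>)\<^sup>2)"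
    unfolding radius_sq using second_order[of 0]
    by (intro Bochner_Integration.integrable_sum) (simp add: square_integrable_def)
qed

lemma projectable_radius_sq: "projectable (\<lambda>\<omega>. (radius \<omega>)\<^sup>2)"
  unfolding projectable_def radius_sq
  using initial_products by (auto simp: sum_distrib_right prodB_def power2_eq_square)

lemma integrable_envelope_radius_sq: "integrable M (\<lambda>\<omega>. envelope \<omega> * (radius \<omega>)\<^sup>2)"
proof -
  have "(\<lambda>\<omega>. envelope \<omega> * (radius \<omega>)\<^sup>2) = (\<lambda>\<omega>. \<Sum>k\<in>S. \<bar>(radius \<omega>)\<^sup>2 * \<Phi> k \<omega>\<bar>)"
    by (auto simp: envelope_def sum_distrib_right abs_mult mult.commute)
  then show ?thesis
    using projectable_radius_sq by (auto simp: projectable_def intro!: Bochner_Integration.integrable_sum integrable_abs)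
qed

lemma ko_deriv:
  "AE \<omega> in M. \<forall>t\<ge>0. \<forall>i. ((\<lambda>s. y i s \<omega>) has_real_derivative ko_rhs (Y t) i \<omega>) (at t within {0..})"
  using system unfolding kraichnan_orszag_def
  by eventually_elim (auto simp: forall_3 ko_rhs_def prodB_def power2_eq_square)

text \<open>Half the derivative of the sum of squares is \<open>y\<^sub>1\<^sup>2 y\<^sub>3 -
  y\<^sub>2\<^sup>2 y\<^sub>3 + (y\<^sub>2\<^sup>2 - y\<^sub>1\<^sup>2) y\<^sub>3 =
  0\<close>.\<close>

lemma radius_conserved: "AE \<omega> in M. \<forall>t\<ge>0. (\<Sum>i\<in>UNIV. (y i t \<omega>)\<^sup>2) = (radius \<omega>)\<^sup>2"
  using ko_deriv
proof eventually_elim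
  case (elim \<omega>)
  have "\<exists>c. \<forall>t\<in>{0..}. (\<Sum>i\<in>UNIV. (y i t \<omega>)\<^sup>2) = c"
  proof (rule has_field_derivative_zero_constant)
    fix t :: real assume "t \<in> {0..}"
    then have d: "((\<lambda>s. y i s \<omega>) has_real_derivative ko_rhs (Y t) i \<omega>) (at t within {0..})" for i
      using elim by simp
    have "((\<lambda>s. \<Sum>i\<in>UNIV. (y i s \<omega>)\<^sup>2) has_real_derivative
        (\<Sum>i\<in>UNIV. 2 * ko_rhs (Y t) i \<omega> * y i t \<omega>)) (at t within {0..})"
      by (intro DERIV_sum) (rule derivative_eq_intros d refl | simp)+
    moreover have "(\<Sum>i\<in>UNIV. 2 * ko_rhs (Y t) i \<omega> * y i t \<omega>) = 0"
      by (simp add: sum_3 ko_rhs_def prodB_def algebra_simps)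
    ultimately show "((\<lambda>s. \<Sum>i\<in>UNIV. (y i s \<omega>)\<^sup>2) has_field_derivative 0) (at t within {0..})"
      by simp
  qed simp
  then show ?case by (auto simp: radius_sq)
qed

lemma y_le_radius: "AE \<omega> in M. \<forall>t\<ge>0. \<forall>i. \<bar>y i t \<omega>\<bar> \<le> radius \<omega>"
  using radius_conserved
proof eventually_elim
  case (elim \<omega>)
  have "\<bar>y i t \<omega>\<bar> \<le> radius \<omega>" if "0 \<le> t" for i t
  proof (rule power2_le_imp_le[OF _ radius_nonneg])
    have "(y i t \<omega>)\<^sup>2 \<le> (\<Sum>i\<in>UNIV. (y i t \<omega>)\<^sup>2)" by (rule member_le_sum) auto
    then show "\<bar>y i t \<omega>\<bar>\<^sup>2 \<le> (radius \<omega>)\<^sup>2" using elim that by simp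
  qed
  then show ?case by blast
qed

text \<open>Provides the time-independent majorant for differentiating the coefficients of the true
  solution under the integral.\<close>

lemma ko_rhs_bound: "AE \<omega> in M. \<forall>t\<ge>0. \<forall>i. \<bar>ko_rhs (Y t) i \<omega>\<bar> \<le> (radius \<omega>)\<^sup>2"
  using radius_conserved
proof eventually_elim
  case (elim \<omega>)
  have prod: "\<bar>a * b\<bar> \<le> a\<^sup>2 + b\<^sup>2" for a b :: real
  proof -
    have "2 * \<bar>a * b\<bar> \<le> a\<^sup>2 + b\<^sup>2"
      using sum_squares_bound[of "\<bar>a\<bar>" "\<bar>b\<bar>"] by (simp add: abs_mult mult.assoc)
    then show ?thesis using abs_ge_zero[of "a * b"] by linarith
  qed
  have "\<bar>ko_rhs (Y t) i \<omega>\<bar> \<le> (radius \<omega>)\<^sup>2" if "0 \<le> t" for i t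
  proof -
    have "(radius \<omega>)\<^sup>2 = (y 1 t \<omega>)\<^sup>2 + (y 2 t \<omega>)\<^sup>2 + (y 3 t \<omega>)\<^sup>2"
      using elim that by (simp add: sum_3)
    moreover note prod[of "y 1 t \<omega>" "y 3 t \<omega>"] prod[of "y 2 t \<omega>" "y 3 t \<omega>"]
    ultimately show ?thesis
      by (auto simp: ko_rhs_def prodB_def simp flip: power2_eq_square) (smt (verit) zero_le_power2)+
  qed
  then show ?case by blast
qed

lemma projectable_bound:
  assumes "projectable g" "f \<in> borel_measurable M" "AE \<omega> in M. \<bar>f \<omega>\<bar> \<le> g \<omega>"
  shows "projectable f"
  unfolding projectable_def
proof
  fix k assume "k \<in> S"
  show "integrable M (\<lambda>\<omega>. f \<omega> * \<Phi> k \<omega>)"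
  proof (rule Bochner_Integration.integrable_bound)
    show "integrable M (\<lambda>\<omega>. g \<omega> * \<Phi> k \<omega>)" using assms(1) \<open>k \<in> S\<close> by (simp add: projectable_def)
    show "(\<lambda>\<omega>. f \<omega> * \<Phi> k \<omega>) \<in> borel_measurable M"
      by (intro borel_measurable_times assms square_integrable_measurable square_integrable_basis)
    show "AE \<omega> in M. norm (f \<omega> * \<Phi> k \<omega>) \<le> norm (g \<omega> * \<Phi> k \<omega>)"
      using assms(3) by eventually_elim (auto simp: abs_mult intro!: mult_right_mono)
  qed
qed

section \<open>Evolution of the coefficients and uniform bounds\<close>

lemma measurable_y: "0 \<le> t \<Longrightarrow> y i t \<in> borel_measurable M"
  by (rule square_integrable_measurable[OF second_order])

lemma projectable_products:
  assumes t: "0 \<le> t"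
  shows "projectable (prodB (y i t) (y j t))"
proof (rule projectable_bound[OF projectable_radius_sq])
  show "prodB (y i t) (y j t) \<in> borel_measurable M"
    unfolding prodB_def by (intro borel_measurable_times measurable_y t)
  show "AE \<omega> in M. \<bar>prodB (y i t) (y j t) \<omega>\<bar> \<le> (radius \<omega>)\<^sup>2"
    using y_le_radius
    by eventually_elim (auto simp: prodB_def abs_mult power2_eq_square t radius_nonneg intro!: mult_mono)
qed

lemma projectable_ko_rhs:
  assumes t: "0 \<le> t"
  shows "projectable (ko_rhs (Y t) i)"
  by (auto simp only: ko_rhs_def split: if_split
      intro!: projectable_add projectable_minus projectable_products t)

text \<open>Differentiation under the integral; conservation supplies the majorant
  \<open>(radius \<omega>)\<^sup>2 * \<bar>\<Phi> k \<omega>\<bar>\<close>, integrable by the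
  assumption on the initial products.\<close>

lemma y_coefficient_deriv:
  assumes t: "0 \<le> t" and k: "k \<in> S"
  shows "((\<lambda>s. l2_inner M (y i s) (\<Phi> k)) has_real_derivative l2_inner M (ko_rhs (Y t) i) (\<Phi> k))
    (at t within {0..})"
  unfolding l2_inner_def
proof (rule has_real_derivative_integral)
  show "integrable M (\<lambda>\<omega>. y i s \<omega> * \<Phi> k \<omega>)" if "s \<in> {0..}" for s
    using that by (intro square_integrable_mult square_integrable_basis second_order) simp
  show "(\<lambda>\<omega>. ko_rhs (Y t) i \<omega> * \<Phi> k \<omega>) \<in> borel_measurable M"
    using projectable_ko_rhs[OF t, of i] k by (auto simp: projectable_def)
  show "integrable M (\<lambda>\<omega>. (radius \<omega>)\<^sup>2 * \<bar>\<Phi> k \<omega>\<bar>)"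
    using projectable_radius_sq k integrable_abs[of M "\<lambda>\<omega>. (radius \<omega>)\<^sup>2 * \<Phi> k \<omega>"]
    by (auto simp: projectable_def abs_mult)
  show "AE \<omega> in M. \<forall>s\<in>{0..}. ((\<lambda>s. y i s \<omega> * \<Phi> k \<omega>) has_real_derivative ko_rhs (Y s) i \<omega> * \<Phi> k \<omega>)
      (at s within {0..}) \<and> \<bar>ko_rhs (Y s) i \<omega> * \<Phi> k \<omega>\<bar> \<le> (radius \<omega>)\<^sup>2 * \<bar>\<Phi> k \<omega>\<bar>"
    using ko_deriv ko_rhs_bound
    by eventually_elim (auto simp: abs_mult intro!: mult_right_mono DERIV_cmult_right)
qed (use t in auto)

text \<open>No domination in time is at hand for \<open>z\<close>. Since \<open>z\<close> lies in a
  finite-dimensional span, differentiability along almost every path already forces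
  differentiability of its coefficients.\<close>

lemma z_coefficient_deriv:
  assumes t: "0 \<le> t" and k: "k \<in> S"
  shows "((\<lambda>s. l2_inner M (z i s) (\<Phi> k)) has_real_derivative l2_inner M (t_rhs t (Z t) i) (\<Phi> k))
    (at t within {0..})"
proof -
  have "AE \<omega> in M. \<forall>i. ((\<lambda>s. z i s \<omega>) has_real_derivative Proj (t_rhs t (Z t) i) \<omega>) (at t within {0..})"
    using reduced unfolding t_model_def
    by eventually_elim (use t in \<open>auto simp: forall_3 Proj_t_rhs[OF resolved_values[OF t]]\<close>)
  then have AE: "AE \<omega> in M. ((\<lambda>s. z i s \<omega>) has_real_derivative Proj (t_rhs t (Z t) i) \<omega>) (at t within {0..})"
    by eventually_elim simp
  \<comment> \<open>Almost every path lies in \<open>G\<close>, so a combination of basis functions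
    that vanishes on \<open>G\<close> vanishes almost everywhere and has zero coefficients.\<close>
  define G where "G = {\<omega>\<in>space M. ((\<lambda>s. z i s \<omega>) has_real_derivative Proj (t_rhs t (Z t) i) \<omega>) (at t within {0..})}"
  show ?thesis
  proof (rule coefficients_have_derivative[OF finite_S, where G = G and \<phi> = \<Phi>, OF _ _ k])
    fix b j assume b: "\<And>\<omega>. \<omega> \<in> G \<Longrightarrow> (\<Sum>i\<in>S. b i * \<Phi> i \<omega>) = 0" and j: "j \<in> S"
    have "AE \<omega> in M. (\<Sum>i\<in>S. b i * \<Phi> i \<omega>) = 0"
      using AE AE_space by eventually_elim (rule b, simp add: G_def)
    then show "b j = 0" using j by (rule basis_independent_AE[OF finite_S])
  next
    fix \<omega> assume "\<omega> \<in> G"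
    then have "((\<lambda>s. z i s \<omega>) has_real_derivative Proj (t_rhs t (Z t) i) \<omega>) (at t within {0..})"
      by (simp add: G_def)
    then show "((\<lambda>s. \<Sum>k\<in>S. l2_inner M (z i s) (\<Phi> k) * \<Phi> k \<omega>) has_real_derivative
        (\<Sum>k\<in>S. l2_inner M (t_rhs t (Z t) i) (\<Phi> k) * \<Phi> k \<omega>)) (at t within {0..})"
      unfolding Proj_eq[OF projectable_t_rhs[OF resolved_values[OF t]]]
    \<comment> \<open>\<open>z\<close> is resolved at nonnegative times only, and the derivative
      within the half-line sees no others.\<close>
    proof (rule has_field_derivative_transform_within[OF _ zero_less_one])
      fix s :: real assume "s \<in> {0..}"
      then show "z i s \<omega> = (\<Sum>k\<in>S. l2_inner M (z i s) (\<Phi> k) * \<Phi> k \<omega>)"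
        using fun_cong[OF span_expansion[OF resolved_values[of s i]], of \<omega>] by simp
    qed (use t in simp)
  qed
qed

text \<open>In coefficients the energy is a finite sum of squares, and Parseval turns its derivative
  into twice the pairing treated in \<open>t_rhs_dissipative\<close>.\<close>

lemma z_energy_le:
  assumes t: "0 \<le> t"
  shows "(l2_norm_vec M (Z t))\<^sup>2 \<le> (l2_norm_vec M (Z 0))\<^sup>2"
proof -
  let ?f = "\<lambda>s. \<Sum>i\<in>UNIV. \<Sum>k\<in>S. (l2_inner M (z i s) (\<Phi> k))\<^sup>2"
  let ?f' = "\<lambda>s. \<Sum>i\<in>UNIV. \<Sum>k\<in>S. 2 * l2_inner M (t_rhs s (Z s) i) (\<Phi> k) * l2_inner M (z i s) (\<Phi> k)"
  have eq: "(l2_norm_vec M (Z s))\<^sup>2 = ?f s" if "0 \<le> s" for s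
    by (simp add: l2_norm_vec_sq l2_norm_span[OF resolved_values[OF that]])
  have "?f t \<le> ?f 0"
  proof (rule nonincreasing_from_0[OF _ _ t])
    fix s :: real assume s: "0 \<le> s"
    show "(?f has_real_derivative ?f' s) (at s within {0..})"
      by (intro DERIV_sum) (rule derivative_eq_intros z_coefficient_deriv[OF s] refl | simp)+
    have "?f' s = 2 * (\<Sum>i\<in>UNIV. l2_inner M (t_rhs s (Z s) i) (z i s))"
      using l2_inner_span[OF projectable_t_rhs[OF resolved_values[OF s]] resolved_values[OF s]]
      by (simp add: sum_distrib_left mult.assoc)
    then show "?f' s \<le> 0" using t_rhs_dissipative[OF resolved_values[OF s] s] by simp
  qed
  then show ?thesis using eq[OF t] eq[of 0] by simp
qed

text \<open>One constant bounding the norms of both \<open>z i t\<close> and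
  \<open>Proj (y i t)\<close> at all times: the first by dissipation, the second by
  conservation.\<close>

definition bnd :: real where
  "bnd = l2_norm_vec M (Z 0) + l2_norm M radius"

lemma bnd_nonneg: "0 \<le> bnd"
  unfolding bnd_def by (intro add_nonneg_nonneg l2_norm_vec_nonneg l2_norm_nonneg)

lemma z_le_envelope:
  assumes t: "0 \<le> t"
  shows "\<bar>z i t \<omega>\<bar> \<le> bnd * envelope \<omega>"
proof -
  have "l2_norm M (z i t) \<le> l2_norm_vec M (Z t)" using l2_norm_le_vec[of M "Z t" i] by simp
  also have "\<dots> \<le> l2_norm_vec M (Z 0)"
    by (rule power2_le_imp_le[OF z_energy_le[OF t] l2_norm_vec_nonneg])
  also have "\<dots> \<le> bnd" by (simp add: bnd_def l2_norm_nonneg)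
  finally have "l2_norm M (z i t) * envelope \<omega> \<le> bnd * envelope \<omega>"
    by (rule mult_right_mono[OF _ envelope_nonneg])
  then show ?thesis using span_le_envelope[OF resolved_values[OF t], of i \<omega>] by linarith
qed

lemma Proj_y_in_span: "0 \<le> t \<Longrightarrow> Proj (y i t) \<in> V"
  by (rule Proj_in_span[OF square_integrable_projectable[OF second_order]])

lemma Proj_y_le_envelope:
  assumes t: "0 \<le> t"
  shows "\<bar>Proj (y i t) \<omega>\<bar> \<le> bnd * envelope \<omega>"
proof -
  have "l2_norm M (Proj (y i t)) \<le> l2_norm M (y i t)" by (rule l2_norm_Proj_le[OF second_order[OF t]])
  also have "\<dots> \<le> l2_norm M radius"
  proof (rule l2_norm_mono[OF square_integrable_radius measurable_y[OF t]])
    show "AE \<omega> in M. \<bar>y i t \<omega>\<bar> \<le> \<bar>radius \<omega>\<bar>"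
      using y_le_radius by eventually_elim (simp add: t radius_nonneg)
  qed
  also have "\<dots> \<le> bnd" by (simp add: bnd_def l2_norm_vec_nonneg)
  finally have "l2_norm M (Proj (y i t)) * envelope \<omega> \<le> bnd * envelope \<omega>"
    by (rule mult_right_mono[OF _ envelope_nonneg])
  then show ?thesis using span_le_envelope[OF Proj_y_in_span[OF t], of i \<omega>] by linarith
qed

section \<open>Derivative of the squared error\<close>

abbreviation err :: "real \<Rightarrow> 3 \<Rightarrow> 'a \<Rightarrow> real" where
  "err t \<equiv> \<lambda>i \<omega>. z i t \<omega> - Proj (y i t) \<omega>"
abbreviation unres :: "real \<Rightarrow> 3 \<Rightarrow> 'a \<Rightarrow> real" where
  "unres t \<equiv> \<lambda>i. Compl (y i t)"

lemma err_in_span: "0 \<le> t \<Longrightarrow> err t i \<in> V"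
  by (rule span_diff[OF resolved_values Proj_y_in_span])

text \<open>The error is resolved, so its squared norm is a finite sum over coefficients whose
  derivatives are known. Testing with \<open>err t i\<close> makes the projections
  disappear.\<close>

lemma err_sq_deriv:
  assumes t: "0 \<le> t"
  shows "((\<lambda>s. (l2_norm_vec M (err s))\<^sup>2) has_real_derivative
    2 * (\<Sum>i\<in>UNIV. l2_inner M (t_rhs t (Z t) i) (err t i) - l2_inner M (ko_rhs (Y t) i) (err t i)))
    (at t within {0..})"
proof -
  have coeff: "l2_inner M (err s i) (\<Phi> k) = l2_inner M (z i s) (\<Phi> k) - l2_inner M (y i s) (\<Phi> k)"
    if s: "0 \<le> s" and k: "k \<in> S" for s i k
  proof -
    have "l2_inner M (err s i) (\<Phi> k) = l2_inner M (z i s) (\<Phi> k) - l2_inner M (Proj (y i s)) (\<Phi> k)"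
      using square_integrable_mult[OF square_integrable_span[OF resolved_values[OF s]] square_integrable_basis]
        square_integrable_mult[OF square_integrable_span[OF Proj_y_in_span[OF s]] square_integrable_basis]
      by (simp add: l2_inner_def left_diff_distrib)
    then show ?thesis
      using l2_inner_Proj[OF square_integrable_projectable[OF second_order[OF s]] k] by simp
  qed
  let ?f = "\<lambda>s. \<Sum>i\<in>UNIV. \<Sum>k\<in>S. (l2_inner M (z i s) (\<Phi> k) - l2_inner M (y i s) (\<Phi> k))\<^sup>2"
  let ?f' = "\<Sum>i\<in>UNIV. \<Sum>k\<in>S.
    2 * (l2_inner M (t_rhs t (Z t) i) (\<Phi> k) - l2_inner M (ko_rhs (Y t) i) (\<Phi> k)) *
      (l2_inner M (z i t) (\<Phi> k) - l2_inner M (y i t) (\<Phi> k))"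
  have "(?f has_real_derivative ?f') (at t within {0..})"
    by (intro DERIV_sum)
      (rule derivative_eq_intros z_coefficient_deriv[OF t] y_coefficient_deriv[OF t] refl | simp)+
  moreover have "?f' = 2 * (\<Sum>i\<in>UNIV. l2_inner M (t_rhs t (Z t) i) (err t i) - l2_inner M (ko_rhs (Y t) i) (err t i))"
    by (simp add: l2_inner_span[OF projectable_t_rhs[OF resolved_values[OF t]] err_in_span[OF t]]
        l2_inner_span[OF projectable_ko_rhs[OF t] err_in_span[OF t]] coeff[OF t]
        sum_distrib_left sum_subtractf[symmetric] algebra_simps)
  ultimately have "(?f has_real_derivative
      2 * (\<Sum>i\<in>UNIV. l2_inner M (t_rhs t (Z t) i) (err t i) - l2_inner M (ko_rhs (Y t) i) (err t i)))
      (at t within {0..})" by simp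
  then show ?thesis
  proof (rule has_field_derivative_transform_within[OF _ zero_less_one])
    fix s :: real assume "s \<in> {0..}"
    then have s: "0 \<le> s" by simp
    show "?f s = (l2_norm_vec M (err s))\<^sup>2"
      by (simp add: l2_norm_vec_sq l2_norm_span[OF err_in_span[OF s]] coeff[OF s])
  qed (use t in simp)
qed

end

section \<open>The error estimate\<close>

context t_model_error
begin

section \<open>Uniform control of the unresolved part weighted by the radius\<close>

lemma unres_le: "AE \<omega> in M. \<forall>t\<ge>0. \<forall>i. \<bar>unres t i \<omega>\<bar> \<le> radius \<omega> + bnd * envelope \<omega>"
  using y_le_radius
proof eventually_elim
  case (elim \<omega>)
  have "\<bar>unres t i \<omega>\<bar> \<le> radius \<omega> + bnd * envelope \<omega>" if t: "0 \<le> t" for t i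
  proof -
    have "\<bar>y i t \<omega>\<bar> \<le> radius \<omega>" using elim t by blast
    then show ?thesis using Proj_y_le_envelope[OF t, of i \<omega>] by (simp add: compl_proj_def)
  qed
  then show ?case by blast
qed

lemma square_integrable_unres: "0 \<le> t \<Longrightarrow> square_integrable M (unres t i)"
  by (rule square_integrable_Compl[OF second_order])

text \<open>This is \<open>K R (R + bnd K)\<close> with \<open>K\<close> the envelope and
  \<open>R\<close> the radius: an integrable bound for \<open>K R \<bar>w\<bar>\<close> valid at all
  times.\<close>

definition dominant :: "'a \<Rightarrow> real" where
  "dominant \<omega> = envelope \<omega> * (radius \<omega>)\<^sup>2 + bnd * ((envelope \<omega> * envelope \<omega>) * radius \<omega>)"

lemma square_integrable_envelope_sq: "square_integrable M (\<lambda>\<omega>. envelope \<omega> * envelope \<omega>)"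
  by (intro all_moments_square_integrable all_moments_mult all_moments_envelope)

lemma integrable_dominant: "integrable M dominant"
  unfolding dominant_def
  by (intro Bochner_Integration.integrable_add integrable_envelope_radius_sq integrable_mult_right
      square_integrable_mult square_integrable_envelope_sq square_integrable_radius)

lemma radius_unres_le_dominant:
  "AE \<omega> in M. \<forall>t\<ge>0. \<forall>i. envelope \<omega> * (radius \<omega> * \<bar>unres t i \<omega>\<bar>) \<le> dominant \<omega>"
  using unres_le
proof eventually_elim
  case (elim \<omega>)
  have "envelope \<omega> * (radius \<omega> * \<bar>unres t i \<omega>\<bar>) \<le> dominant \<omega>" if "0 \<le> t" for t i
  proof -
    have "envelope \<omega> * (radius \<omega> * \<bar>unres t i \<omega>\<bar>) \<le> envelope \<omega> * (radius \<omega> * (radius \<omega> + bnd * envelope \<omega>))"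
      using elim that by (intro mult_left_mono envelope_nonneg radius_nonneg) blast
    then show ?thesis by (simp add: dominant_def power2_eq_square algebra_simps)
  qed
  then show ?case by blast
qed

lemma integrable_radius_unres:
  assumes t: "0 \<le> t"
  shows "integrable M (\<lambda>\<omega>. envelope \<omega> * (radius \<omega> * \<bar>unres t i \<omega>\<bar>))"
proof (rule Bochner_Integration.integrable_bound[OF integrable_dominant])
  show "(\<lambda>\<omega>. envelope \<omega> * (radius \<omega> * \<bar>unres t i \<omega>\<bar>)) \<in> borel_measurable M"
    by (intro borel_measurable_times borel_measurable_abs all_moments_measurable[OF all_moments_envelope]
        square_integrable_measurable square_integrable_radius square_integrable_unres t)
  show "AE \<omega> in M. norm (envelope \<omega> * (radius \<omega> * \<bar>unres t i \<omega>\<bar>)) \<le> norm (dominant \<omega>)"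
    using radius_unres_le_dominant
  proof eventually_elim
    case (elim \<omega>)
    then have "envelope \<omega> * (radius \<omega> * \<bar>unres t i \<omega>\<bar>) \<le> dominant \<omega>" using t by blast
    then show ?case by (simp add: abs_mult envelope_nonneg radius_nonneg)
  qed
qed

text \<open>\<open>radius\<close> is conserved and \<open>(radius)\<^sup>2 \<le> 2 \<Sum>(P y\<^sub>i)\<^sup>2 + 2 \<Sum>((I - P) y\<^sub>i)\<^sup>2\<close> at every time;
  the last sum can be made arbitrarily small in mean.\<close>

lemma radius_le_envelope:
  assumes small: "\<And>\<delta>. 0 < \<delta> \<Longrightarrow> \<exists>t\<ge>0. l2_norm_vec M (unres t) < \<delta>"
  shows "AE \<omega> in M. radius \<omega> \<le> 3 * bnd * envelope \<omega>"
proof -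
  \<comment> \<open>\<open>h\<close> does not depend on time, yet its mean is at most twice the
    squared norm of \<open>unres t\<close> for every \<open>t\<close>, which forces it to vanish.
    The 6 is 2 for each of the three components.\<close>
  define h where "h = (\<lambda>\<omega>. max 0 ((radius \<omega>)\<^sup>2 - 6 * (bnd * envelope \<omega>)\<^sup>2))"
  have h_meas: "h \<in> borel_measurable M"
    unfolding h_def
    using all_moments_measurable[OF all_moments_envelope] square_integrable_measurable[OF square_integrable_radius]
    by measurable
  have h_int: "integrable M h"
  proof (rule Bochner_Integration.integrable_bound[OF _ h_meas])
    show "integrable M (\<lambda>\<omega>. (radius \<omega>)\<^sup>2)"
      using square_integrable_radius by (simp add: square_integrable_def)
  qed (simp add: h_def max_def)
  have le: "(LINT \<omega>|M. h \<omega>) \<le> 2 * (l2_norm_vec M (unres t))\<^sup>2" if t: "0 \<le> t" for t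
  proof -
    have sq: "integrable M (\<lambda>\<omega>. unres t i \<omega> * unres t i \<omega>)" for i
      by (intro square_integrable_mult square_integrable_unres t)
    have "(LINT \<omega>|M. h \<omega>) \<le> (LINT \<omega>|M. 2 * (\<Sum>i\<in>UNIV. unres t i \<omega> * unres t i \<omega>))"
    proof (rule integral_mono_AE[OF h_int])
      show "integrable M (\<lambda>\<omega>. 2 * (\<Sum>i\<in>UNIV. unres t i \<omega> * unres t i \<omega>))"
        using sq by (intro integrable_mult_right Bochner_Integration.integrable_sum)
      show "AE \<omega> in M. h \<omega> \<le> 2 * (\<Sum>i\<in>UNIV. unres t i \<omega> * unres t i \<omega>)"
        using radius_conserved
      proof eventually_elim
        case (elim \<omega>)
        have "(y i t \<omega>)\<^sup>2 \<le> 2 * (bnd * envelope \<omega>)\<^sup>2 + 2 * (unres t i \<omega> * unres t i \<omega>)" for i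
        proof -
          have "(Proj (y i t) \<omega>)\<^sup>2 \<le> (bnd * envelope \<omega>)\<^sup>2"
            using power_mono[OF Proj_y_le_envelope[OF t, of i \<omega>], of 2] by simp
          \<comment> \<open>This square supplies the cross term in
            \<open>(a + b)\<^sup>2 \<le> 2 a\<^sup>2 + 2 b\<^sup>2\<close>.\<close>
          moreover have "0 \<le> (Proj (y i t) \<omega> - unres t i \<omega>)\<^sup>2" by simp
          moreover have "y i t \<omega> = Proj (y i t) \<omega> + unres t i \<omega>" by (simp add: compl_proj_def)
          ultimately show ?thesis by (simp add: power2_sum power2_diff flip: power2_eq_square)
        qed
        then have "(\<Sum>i\<in>(UNIV::3 set). (y i t \<omega>)\<^sup>2)
            \<le> (\<Sum>i\<in>(UNIV::3 set). 2 * (bnd * envelope \<omega>)\<^sup>2 + 2 * (unres t i \<omega> * unres t i \<omega>))"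
          by (rule sum_mono)
        then have "(radius \<omega>)\<^sup>2 \<le> 6 * (bnd * envelope \<omega>)\<^sup>2 + 2 * (\<Sum>i\<in>UNIV. unres t i \<omega> * unres t i \<omega>)"
          using elim t by (simp add: sum.distrib sum_distrib_left)
        moreover have "0 \<le> (\<Sum>i\<in>UNIV. unres t i \<omega> * unres t i \<omega>)" by (simp add: sum_nonneg)
        ultimately show ?case by (simp add: h_def)
      qed
    qed
    also have "\<dots> = 2 * (l2_norm_vec M (unres t))\<^sup>2"
      using sq by (simp add: l2_norm_vec_sq l2_norm_sq l2_inner_def)
    finally show ?thesis .
  qed
  have "(LINT \<omega>|M. h \<omega>) \<le> 0"
  proof (rule ccontr)
    assume neg: "\<not> ?thesis"
    then obtain t where t: "0 \<le> t" "l2_norm_vec M (unres t) < sqrt ((LINT \<omega>|M. h \<omega>) / 2)"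
      using small[of "sqrt ((LINT \<omega>|M. h \<omega>) / 2)"] by auto
    then have "(l2_norm_vec M (unres t))\<^sup>2 < (sqrt ((LINT \<omega>|M. h \<omega>) / 2))\<^sup>2"
      by (intro power_strict_mono l2_norm_vec_nonneg) auto
    then show False using le[OF t(1)] neg by simp
  qed
  moreover have "0 \<le> (LINT \<omega>|M. h \<omega>)" by (rule integral_nonneg_AE) (simp add: h_def)
  moreover have "AE \<omega> in M. 0 \<le> h \<omega>" by (simp add: h_def)
  ultimately have "AE \<omega> in M. h \<omega> = 0"
    using integral_nonneg_eq_0_iff_AE[OF h_int] by linarith
  then show ?thesis
  proof eventually_elim
    case (elim \<omega>)
    show ?case
    proof (rule power2_le_imp_le)
      have "(radius \<omega>)\<^sup>2 \<le> 6 * (bnd * envelope \<omega>)\<^sup>2" using elim by (simp add: h_def max_def split: if_splits)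
      \<comment> \<open>Rounding 6 up to a perfect square gives the factor 3.\<close>
      also have "\<dots> \<le> 9 * (bnd * envelope \<omega>)\<^sup>2" by simp
      finally show "(radius \<omega>)\<^sup>2 \<le> (3 * bnd * envelope \<omega>)\<^sup>2" by (simp add: power_mult_distrib)
    qed (intro mult_nonneg_nonneg bnd_nonneg envelope_nonneg, simp)
  qed
qed

lemma radius_unres_bound:
  obtains C where "0 \<le> C"
    "\<And>t i. 0 \<le> t \<Longrightarrow> (LINT \<omega>|M. envelope \<omega> * (radius \<omega> * \<bar>unres t i \<omega>\<bar>)) \<le> C * l2_norm_vec M (unres t)"
proof (cases "\<exists>\<delta>>0. \<forall>t\<ge>0. \<delta> \<le> l2_norm_vec M (unres t)")
  case True
  then obtain \<delta> where \<delta>: "0 < \<delta>" "\<And>t. 0 \<le> t \<Longrightarrow> \<delta> \<le> l2_norm_vec M (unres t)" by blast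
  have dom: "0 \<le> (LINT \<omega>|M. dominant \<omega>)"
    by (rule integral_nonneg_AE)
      (simp add: dominant_def envelope_nonneg radius_nonneg bnd_nonneg)
  show thesis
  \<comment> \<open>The integral of \<open>dominant\<close> bounds the left side at all times, and
    \<open>\<delta>\<close> bounds the norm of \<open>unres t\<close> from below, so their quotient
    is an admissible constant.\<close>
  proof (rule that[of "(LINT \<omega>|M. dominant \<omega>) / \<delta>"])
    show "0 \<le> (LINT \<omega>|M. dominant \<omega>) / \<delta>" using dom \<delta> by simp
    fix t :: real and i assume t: "0 \<le> t"
    have "(LINT \<omega>|M. envelope \<omega> * (radius \<omega> * \<bar>unres t i \<omega>\<bar>)) \<le> (LINT \<omega>|M. dominant \<omega>)"
    proof (rule integral_mono_AE[OF integrable_radius_unres[OF t] integrable_dominant])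
      show "AE \<omega> in M. envelope \<omega> * (radius \<omega> * \<bar>unres t i \<omega>\<bar>) \<le> dominant \<omega>"
        using radius_unres_le_dominant by eventually_elim (use t in blast)
    qed
    also have "\<dots> = (LINT \<omega>|M. dominant \<omega>) / \<delta> * \<delta>" using \<delta> by simp
    also have "\<dots> \<le> (LINT \<omega>|M. dominant \<omega>) / \<delta> * l2_norm_vec M (unres t)"
      using \<delta> dom t by (intro mult_left_mono) auto
    finally show "(LINT \<omega>|M. envelope \<omega> * (radius \<omega> * \<bar>unres t i \<omega>\<bar>))
      \<le> (LINT \<omega>|M. dominant \<omega>) / \<delta> * l2_norm_vec M (unres t)" .
  qed
next
  case False
  then have AE: "AE \<omega> in M. radius \<omega> \<le> 3 * bnd * envelope \<omega>"
    by (intro radius_le_envelope) (auto simp: not_le)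
  let ?m = "l2_norm M (\<lambda>\<omega>. envelope \<omega> * envelope \<omega>)"
  show thesis
  \<comment> \<open>Replacing the radius by its envelope bound leaves
    \<open>3 bnd K\<^sup>2 \<bar>w\<bar>\<close>, where \<open>K\<^sup>2\<close> is
    square-integrable.\<close>
  proof (rule that[of "3 * bnd * ?m"])
    show "0 \<le> 3 * bnd * ?m" by (intro mult_nonneg_nonneg bnd_nonneg l2_norm_nonneg) simp
    fix t :: real and i assume t: "0 \<le> t"
    have int: "integrable M (\<lambda>\<omega>. \<bar>envelope \<omega> * envelope \<omega>\<bar> * \<bar>unres t i \<omega>\<bar>)"
      by (intro square_integrable_mult square_integrable_abs square_integrable_envelope_sq square_integrable_unres t)
    have "(LINT \<omega>|M. envelope \<omega> * (radius \<omega> * \<bar>unres t i \<omega>\<bar>))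
        \<le> (LINT \<omega>|M. (3 * bnd) * (\<bar>envelope \<omega> * envelope \<omega>\<bar> * \<bar>unres t i \<omega>\<bar>))"
    proof (rule integral_mono_AE[OF integrable_radius_unres[OF t] integrable_mult_right[OF int]])
      show "AE \<omega> in M. envelope \<omega> * (radius \<omega> * \<bar>unres t i \<omega>\<bar>)
          \<le> (3 * bnd) * (\<bar>envelope \<omega> * envelope \<omega>\<bar> * \<bar>unres t i \<omega>\<bar>)"
        using AE
      proof eventually_elim
        case (elim \<omega>)
        have "envelope \<omega> * (radius \<omega> * \<bar>unres t i \<omega>\<bar>)
            \<le> envelope \<omega> * ((3 * bnd * envelope \<omega>) * \<bar>unres t i \<omega>\<bar>)"
          by (intro mult_left_mono mult_right_mono elim envelope_nonneg abs_ge_zero)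
        then show ?case by (simp add: abs_mult envelope_nonneg ac_simps)
      qed
    qed
    also have "\<dots> \<le> (3 * bnd) * (?m * l2_norm M (unres t i))"
      using Cauchy_Schwarz_abs[OF square_integrable_envelope_sq square_integrable_unres[OF t, of i]] bnd_nonneg
      by (simp only: integral_mult_right_zero) (intro mult_left_mono, auto)
    also have "\<dots> \<le> (3 * bnd) * (?m * l2_norm_vec M (unres t))"
      using l2_norm_le_vec[of M "unres t" i] bnd_nonneg
      by (intro mult_left_mono l2_norm_nonneg) auto
    finally show "(LINT \<omega>|M. envelope \<omega> * (radius \<omega> * \<bar>unres t i \<omega>\<bar>)) \<le> 3 * bnd * ?m * l2_norm_vec M (unres t)"
      by (simp add: mult.assoc)
  qed
qed

section \<open>Estimates for the quadratic and the memory terms\<close>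

lemma err_le: "0 \<le> t \<Longrightarrow> \<bar>err t i \<omega>\<bar> \<le> l2_norm_vec M (err t) * envelope \<omega>"
  by (rule order_trans[OF span_le_envelope[OF err_in_span]], assumption)
    (rule mult_right_mono[OF l2_norm_le_vec envelope_nonneg])

text \<open>The difference is \<open>e\<^sub>i z\<^sub>j + u\<^sub>i e\<^sub>j\<close> with
  \<open>u = P y\<close>; in each summand the error brings its norm times the envelope and the other
  factor brings \<open>bnd\<close> times the envelope.\<close>

lemma z_Proj_products_le:
  assumes t: "0 \<le> t"
  shows "\<bar>prodB (z i t) (z j t) \<omega> - prodB (Proj (y i t)) (Proj (y j t)) \<omega>\<bar>
    \<le> 2 * bnd * l2_norm_vec M (err t) * (envelope \<omega> * envelope \<omega>)"
proof -
  let ?E = "l2_norm_vec M (err t)"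
  have "prodB (z i t) (z j t) \<omega> - prodB (Proj (y i t)) (Proj (y j t)) \<omega>
      = err t i \<omega> * z j t \<omega> + Proj (y i t) \<omega> * err t j \<omega>"
    by (simp add: prodB_def algebra_simps)
  moreover have "\<bar>err t i \<omega>\<bar> * \<bar>z j t \<omega>\<bar> \<le> (?E * envelope \<omega>) * (bnd * envelope \<omega>)"
    by (intro mult_mono err_le z_le_envelope t mult_nonneg_nonneg l2_norm_vec_nonneg envelope_nonneg abs_ge_zero)
  moreover have "\<bar>Proj (y i t) \<omega>\<bar> * \<bar>err t j \<omega>\<bar> \<le> (bnd * envelope \<omega>) * (?E * envelope \<omega>)"
    by (intro mult_mono err_le Proj_y_le_envelope t mult_nonneg_nonneg bnd_nonneg envelope_nonneg abs_ge_zero)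
  ultimately have "\<bar>prodB (z i t) (z j t) \<omega> - prodB (Proj (y i t)) (Proj (y j t)) \<omega>\<bar>
      \<le> (?E * envelope \<omega>) * (bnd * envelope \<omega>) + (bnd * envelope \<omega>) * (?E * envelope \<omega>)"
    by (simp only: abs_mult[symmetric])
  then show ?thesis by (simp add: algebra_simps)
qed

text \<open>With \<open>u = P y\<close> and \<open>w = y - u\<close>, the difference
  \<open>z\<^sub>i z\<^sub>j - y\<^sub>i y\<^sub>j\<close> equals \<open>(z\<^sub>i z\<^sub>j -
  u\<^sub>i u\<^sub>j) - (y\<^sub>j w\<^sub>i + u\<^sub>i w\<^sub>j)\<close>. Only
  \<open>y\<^sub>j w\<^sub>i\<close> lacks a resolved factor; it is bounded by the radius times
  \<open>\<bar>w\<^sub>i\<bar>\<close> and needs \<open>radius_unres_bound\<close>.\<close>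

lemma products_bound:
  obtains A C where "0 \<le> A" "0 \<le> C"
    "\<And>t i j l. 0 \<le> t \<Longrightarrow>
      \<bar>l2_inner M (prodB (z i t) (z j t)) (err t l) - l2_inner M (prodB (y i t) (y j t)) (err t l)\<bar>
      \<le> l2_norm_vec M (err t) * (A * l2_norm_vec M (err t) + C * l2_norm_vec M (unres t))"
proof -
  obtain C0 where C0: "0 \<le> C0" "\<And>t i. 0 \<le> t \<Longrightarrow>
    (LINT \<omega>|M. envelope \<omega> * (radius \<omega> * \<bar>unres t i \<omega>\<bar>)) \<le> C0 * l2_norm_vec M (unres t)"
    by (rule radius_unres_bound) (rule that)
  let ?m = "l2_norm M (\<lambda>\<omega>. envelope \<omega> * envelope \<omega>)"
  define m3 where "m3 = (LINT \<omega>|M. envelope \<omega> * (envelope \<omega> * envelope \<omega>))"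
  have int3: "integrable M (\<lambda>\<omega>. envelope \<omega> * (envelope \<omega> * envelope \<omega>))"
    by (intro all_moments_integrable all_moments_mult all_moments_envelope)
  have m3: "0 \<le> m3" unfolding m3_def by (rule integral_nonneg_AE) (simp add: envelope_nonneg)
  show thesis
  proof (rule that[of "2 * bnd * m3" "C0 + bnd * ?m"])
    show "0 \<le> 2 * bnd * m3" using bnd_nonneg m3 by simp
    show "0 \<le> C0 + bnd * ?m"
      by (intro add_nonneg_nonneg mult_nonneg_nonneg bnd_nonneg C0(1) l2_norm_nonneg)
    fix t :: real and i j l assume t: "0 \<le> t"
    let ?E = "l2_norm_vec M (err t)" and ?W = "l2_norm_vec M (unres t)"
    define f where "f = (\<lambda>\<omega>. prodB (z i t) (z j t) \<omega> - prodB (y i t) (y j t) \<omega>)"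
    define g where "g = (\<lambda>\<omega>. (2 * bnd * ?E) * (envelope \<omega> * (envelope \<omega> * envelope \<omega>))
      + envelope \<omega> * (radius \<omega> * \<bar>unres t i \<omega>\<bar>) + bnd * (\<bar>envelope \<omega> * envelope \<omega>\<bar> * \<bar>unres t j \<omega>\<bar>))"
    have pz: "projectable (prodB (z i t) (z j t))" by (rule projectable_pair[of "Z t", OF resolved_values[OF t]])
    have f_proj: "projectable f"
      using projectable_lincomb[OF pz projectable_products[OF t, of i j], of "-1"] by (simp add: f_def)
    have int_w: "integrable M (\<lambda>\<omega>. \<bar>envelope \<omega> * envelope \<omega>\<bar> * \<bar>unres t j \<omega>\<bar>)"
      by (intro square_integrable_mult square_integrable_abs square_integrable_envelope_sq square_integrable_unres t)
    have g_int: "integrable M g"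
      unfolding g_def by (intro Bochner_Integration.integrable_add integrable_mult_right int3 int_w
          integrable_radius_unres t)
    have fg: "AE \<omega> in M. envelope \<omega> * \<bar>f \<omega>\<bar> \<le> g \<omega>"
      using y_le_radius
    proof eventually_elim
      case (elim \<omega>)
      have "f \<omega> = (prodB (z i t) (z j t) \<omega> - prodB (Proj (y i t)) (Proj (y j t)) \<omega>)
          - (y j t \<omega> * unres t i \<omega> + Proj (y i t) \<omega> * unres t j \<omega>)"
        by (simp add: f_def prodB_def compl_proj_def algebra_simps)
      moreover have "\<bar>y j t \<omega> * unres t i \<omega>\<bar> \<le> radius \<omega> * \<bar>unres t i \<omega>\<bar>"
        unfolding abs_mult using elim t by (intro mult_right_mono) auto
      moreover have "\<bar>Proj (y i t) \<omega> * unres t j \<omega>\<bar> \<le> (bnd * envelope \<omega>) * \<bar>unres t j \<omega>\<bar>"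
        unfolding abs_mult by (intro mult_right_mono Proj_y_le_envelope t) auto
      ultimately have "\<bar>f \<omega>\<bar> \<le> 2 * bnd * ?E * (envelope \<omega> * envelope \<omega>) + radius \<omega> * \<bar>unres t i \<omega>\<bar>
          + (bnd * envelope \<omega>) * \<bar>unres t j \<omega>\<bar>"
        using z_Proj_products_le[OF t, of i j \<omega>] by linarith
      from mult_left_mono[OF this envelope_nonneg[of \<omega>]] show ?case
        by (simp add: g_def abs_mult envelope_nonneg algebra_simps)
    qed
    have f_meas: "f \<in> borel_measurable M"
      unfolding f_def using all_moments_measurable[OF all_moments_pair[of "Z t", OF resolved_values[OF t]], of i j]
      by (intro borel_measurable_diff) (auto simp: prodB_def intro!: borel_measurable_times measurable_y t)
    have f_int: "integrable M (\<lambda>\<omega>. envelope \<omega> * \<bar>f \<omega>\<bar>)"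
    proof (rule Bochner_Integration.integrable_bound[OF g_int])
      show "(\<lambda>\<omega>. envelope \<omega> * \<bar>f \<omega>\<bar>) \<in> borel_measurable M"
        by (intro borel_measurable_times borel_measurable_abs f_meas all_moments_measurable all_moments_envelope)
      show "AE \<omega> in M. norm (envelope \<omega> * \<bar>f \<omega>\<bar>) \<le> norm (g \<omega>)"
        using fg by eventually_elim (simp add: abs_mult envelope_nonneg)
    qed
    have "(LINT \<omega>|M. envelope \<omega> * \<bar>f \<omega>\<bar>) \<le> (LINT \<omega>|M. g \<omega>)"
      by (rule integral_mono_AE[OF f_int g_int fg])
    also have "\<dots> = (2 * bnd * ?E) * m3 + (LINT \<omega>|M. envelope \<omega> * (radius \<omega> * \<bar>unres t i \<omega>\<bar>))
        + bnd * (LINT \<omega>|M. \<bar>envelope \<omega> * envelope \<omega>\<bar> * \<bar>unres t j \<omega>\<bar>)"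
      unfolding g_def m3_def using int3 int_w integrable_radius_unres[OF t, of i]
      by (simp add: Bochner_Integration.integral_add)
    also have "\<dots> \<le> (2 * bnd * ?E) * m3 + C0 * ?W + bnd * (?m * ?W)"
    proof (intro add_mono order_refl C0(2) t mult_left_mono bnd_nonneg)
      have "(LINT \<omega>|M. \<bar>envelope \<omega> * envelope \<omega>\<bar> * \<bar>unres t j \<omega>\<bar>) \<le> ?m * l2_norm M (unres t j)"
        by (rule Cauchy_Schwarz_abs[OF square_integrable_envelope_sq square_integrable_unres[OF t]])
      also have "\<dots> \<le> ?m * ?W"
        by (intro mult_left_mono l2_norm_nonneg) (rule l2_norm_le_vec)
      finally show "(LINT \<omega>|M. \<bar>envelope \<omega> * envelope \<omega>\<bar> * \<bar>unres t j \<omega>\<bar>) \<le> ?m * ?W" .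
    qed
    finally have fle: "(LINT \<omega>|M. envelope \<omega> * \<bar>f \<omega>\<bar>) \<le> 2 * bnd * m3 * ?E + (C0 + bnd * ?m) * ?W"
      by (simp add: algebra_simps)
    have "l2_inner M f (err t l) = l2_inner M (prodB (z i t) (z j t)) (err t l) - l2_inner M (prodB (y i t) (y j t)) (err t l)"
      using l2_inner_lincomb[OF pz projectable_products[OF t, of i j] err_in_span[OF t], of "-1" l] by (simp add: f_def)
    then have "\<bar>l2_inner M (prodB (z i t) (z j t)) (err t l) - l2_inner M (prodB (y i t) (y j t)) (err t l)\<bar>
        \<le> l2_norm M (err t l) * (LINT \<omega>|M. envelope \<omega> * \<bar>f \<omega>\<bar>)"
      using l2_inner_le_envelope[OF err_in_span[OF t] f_proj f_int, of l] by simp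
    also have "\<dots> \<le> ?E * (LINT \<omega>|M. envelope \<omega> * \<bar>f \<omega>\<bar>)"
    proof (rule mult_right_mono)
      show "l2_norm M (err t l) \<le> ?E" by (rule l2_norm_le_vec)
      show "0 \<le> (LINT \<omega>|M. envelope \<omega> * \<bar>f \<omega>\<bar>)"
        by (rule integral_nonneg_AE) (simp add: envelope_nonneg)
    qed
    also have "\<dots> \<le> ?E * (2 * bnd * m3 * ?E + (C0 + bnd * ?m) * ?W)"
      by (rule mult_left_mono[OF fle l2_norm_vec_nonneg])
    finally show "\<bar>l2_inner M (prodB (z i t) (z j t)) (err t l) - l2_inner M (prodB (y i t) (y j t)) (err t l)\<bar>
      \<le> ?E * (2 * bnd * m3 * ?E + (C0 + bnd * ?m) * ?W)" .
  qed
qed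

text \<open>The unresolved part of \<open>z\<^sub>i z\<^sub>j\<close> is that of the projected
  product plus the unresolved part of a difference of order \<open>2 bnd E K\<^sup>2\<close>, with
  \<open>E\<close> the error norm. The factor \<open>z\<^sub>m\<close> and the test function
  contribute \<open>bnd K\<close> and \<open>E K\<close>, and the Cauchy-Schwarz inequality
  concludes.\<close>

lemma cubic_bound:
  obtains D where "0 \<le> D"
    "\<And>t m i j l. 0 \<le> t \<Longrightarrow> \<bar>l2_inner M (cubic (Z t) m i j) (err t l)\<bar>
      \<le> D * l2_norm_vec M (err t) *
        (l2_norm M (Compl (prodB (Proj (y i t)) (Proj (y j t)))) + D * l2_norm_vec M (err t))"
proof -
  let ?m = "l2_norm M (\<lambda>\<omega>. envelope \<omega> * envelope \<omega>)"
  have B: "0 \<le> bnd * ?m" by (intro mult_nonneg_nonneg bnd_nonneg l2_norm_nonneg)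
  show thesis
  proof (rule that[of "2 * (bnd * ?m)"])
    show "0 \<le> 2 * (bnd * ?m)" using B by simp
    fix t :: real and m i j l assume t: "0 \<le> t"
    let ?E = "l2_norm_vec M (err t)"
    let ?p = "prodB (Proj (y i t)) (Proj (y j t))"
    define d where "d = (\<lambda>\<omega>. prodB (z i t) (z j t) \<omega> - ?p \<omega>)"
    define X where "X = Compl (prodB (z i t) (z j t))"
    have zz: "all_moments M (prodB (z i t) (z j t))"
      by (rule all_moments_pair[of "Z t", OF resolved_values[OF t]])
    have pp: "all_moments M ?p"
      by (intro all_moments_prodB all_moments_span Proj_y_in_span t)
    have d: "all_moments M d" unfolding d_def by (rule all_moments_diff[OF zz pp])
    have X: "all_moments M X" unfolding X_def by (rule all_moments_Compl[OF zz])
    have "X = (\<lambda>\<omega>. Compl ?p \<omega> + Compl d \<omega>)"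
      using Compl_add[OF all_moments_projectable[OF pp] all_moments_projectable[OF d]]
      by (simp add: X_def d_def)
    then have "l2_norm M X \<le> l2_norm M (Compl ?p) + l2_norm M (Compl d)"
      by (simp only: l2_norm_triangle[OF square_integrable_Compl[OF all_moments_square_integrable[OF pp]]
            square_integrable_Compl[OF all_moments_square_integrable[OF d]]])
    also have "l2_norm M (Compl d) \<le> l2_norm M d"
      by (rule l2_norm_Compl_le[OF all_moments_square_integrable[OF d]])
    also have "l2_norm M d \<le> l2_norm M (\<lambda>\<omega>. (2 * bnd * ?E) * (envelope \<omega> * envelope \<omega>))"
    proof (rule l2_norm_mono)
      show "square_integrable M (\<lambda>\<omega>. (2 * bnd * ?E) * (envelope \<omega> * envelope \<omega>))"
        by (rule square_integrable_cmult[OF square_integrable_envelope_sq])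
      show "d \<in> borel_measurable M" by (rule all_moments_measurable[OF d])
      show "AE \<omega> in M. \<bar>d \<omega>\<bar> \<le> \<bar>(2 * bnd * ?E) * (envelope \<omega> * envelope \<omega>)\<bar>"
        using z_Proj_products_le[OF t, of i j]
        by (intro AE_I2) (auto simp: d_def intro: order_trans[OF _ abs_ge_self])
    qed
    also have "\<dots> = 2 * (bnd * ?m) * ?E"
      using bnd_nonneg l2_norm_vec_nonneg[of M "err t"] by (simp add: l2_norm_cmult abs_mult)
    finally have X_le: "l2_norm M X \<le> l2_norm M (Compl ?p) + 2 * (bnd * ?m) * ?E" by simp
    have c: "cubic (Z t) m i j = prodB (z m t) X" by (simp add: cubic_def X_def)
    have c_all: "all_moments M (prodB (z m t) X)"
      by (intro all_moments_prodB X all_moments_span resolved_values t)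
    have int_c: "integrable M (\<lambda>\<omega>. envelope \<omega> * \<bar>prodB (z m t) X \<omega>\<bar>)"
      by (intro all_moments_integrable all_moments_mult all_moments_abs all_moments_envelope c_all)
    have int_X: "integrable M (\<lambda>\<omega>. \<bar>envelope \<omega> * envelope \<omega>\<bar> * \<bar>X \<omega>\<bar>)"
      by (intro all_moments_integrable all_moments_mult all_moments_abs all_moments_envelope X)
    have "\<bar>l2_inner M (prodB (z m t) X) (err t l)\<bar> \<le> l2_norm M (err t l) * (LINT \<omega>|M. envelope \<omega> * \<bar>prodB (z m t) X \<omega>\<bar>)"
      by (rule l2_inner_le_envelope[OF err_in_span[OF t] all_moments_projectable[OF c_all] int_c])
    also have "\<dots> \<le> ?E * (LINT \<omega>|M. bnd * (\<bar>envelope \<omega> * envelope \<omega>\<bar> * \<bar>X \<omega>\<bar>))"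
    proof (rule mult_mono[OF _ _ l2_norm_vec_nonneg])
      show "l2_norm M (err t l) \<le> ?E" by (rule l2_norm_le_vec)
      show "0 \<le> (LINT \<omega>|M. envelope \<omega> * \<bar>prodB (z m t) X \<omega>\<bar>)"
        by (rule integral_nonneg_AE) (simp add: envelope_nonneg)
      show "(LINT \<omega>|M. envelope \<omega> * \<bar>prodB (z m t) X \<omega>\<bar>) \<le> (LINT \<omega>|M. bnd * (\<bar>envelope \<omega> * envelope \<omega>\<bar> * \<bar>X \<omega>\<bar>))"
      proof (rule integral_mono[OF int_c integrable_mult_right[OF int_X]])
        fix \<omega>
        have "envelope \<omega> * (\<bar>z m t \<omega>\<bar> * \<bar>X \<omega>\<bar>) \<le> envelope \<omega> * ((bnd * envelope \<omega>) * \<bar>X \<omega>\<bar>)"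
          by (intro mult_left_mono mult_right_mono z_le_envelope t envelope_nonneg abs_ge_zero)
        then show "envelope \<omega> * \<bar>prodB (z m t) X \<omega>\<bar> \<le> bnd * (\<bar>envelope \<omega> * envelope \<omega>\<bar> * \<bar>X \<omega>\<bar>)"
          by (simp add: prodB_def abs_mult envelope_nonneg ac_simps)
      qed
    qed
    also have "\<dots> \<le> ?E * (bnd * (?m * l2_norm M X))"
      unfolding integral_mult_right_zero
      by (intro mult_left_mono l2_norm_vec_nonneg bnd_nonneg Cauchy_Schwarz_abs
          square_integrable_envelope_sq all_moments_square_integrable[OF X])
    also have "\<dots> = (bnd * ?m) * (?E * l2_norm M X)" by simp
    \<comment> \<open>The outer constant is doubled so that the same \<open>D\<close> serves in both
      places.\<close>
    also have "\<dots> \<le> (2 * (bnd * ?m)) * (?E * l2_norm M X)"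
      using B by (intro mult_right_mono mult_nonneg_nonneg l2_norm_vec_nonneg l2_norm_nonneg) simp
    also have "\<dots> \<le> (2 * (bnd * ?m)) * (?E * (l2_norm M (Compl ?p) + 2 * (bnd * ?m) * ?E))"
      using B X_le by (intro mult_left_mono l2_norm_vec_nonneg) auto
    finally show "\<bar>l2_inner M (cubic (Z t) m i j) (err t l)\<bar>
      \<le> 2 * (bnd * ?m) * ?E * (l2_norm M (Compl ?p) + 2 * (bnd * ?m) * ?E)"
      unfolding c by (simp only: mult.assoc)
  qed
qed

lemma error_growth:
  "\<exists>A B C :: real. \<forall>t\<ge>0. \<exists>D.
    ((\<lambda>s. (l2_norm_vec M (err s))\<^sup>2) has_real_derivative D) (at t within {0..}) \<and>
    1 / 2 * D \<le> (A + t * B) * (l2_norm_vec M (err t))\<^sup>2 + C * (l2_norm_vec M (unres t))\<^sup>2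
      + 5 * t * (l2_norm M (Compl (prodB (Proj (y 1 t)) (Proj (y 3 t)))))\<^sup>2
      + 5 * t * (l2_norm M (Compl (prodB (Proj (y 2 t)) (Proj (y 3 t)))))\<^sup>2
      + t * (l2_norm M (Compl (prodB (Proj (y 1 t)) (Proj (y 1 t)))))\<^sup>2
      + t * (l2_norm M (Compl (prodB (Proj (y 2 t)) (Proj (y 2 t)))))\<^sup>2"
proof -
  obtain A C where AC: "\<And>t i j l. 0 \<le> t \<Longrightarrow>
      \<bar>l2_inner M (prodB (z i t) (z j t)) (err t l) - l2_inner M (prodB (y i t) (y j t)) (err t l)\<bar>
      \<le> l2_norm_vec M (err t) * (A * l2_norm_vec M (err t) + C * l2_norm_vec M (unres t))"
    by (rule products_bound) (rule that)
  obtain D where D: "\<And>t m i j l. 0 \<le> t \<Longrightarrow> \<bar>l2_inner M (cubic (Z t) m i j) (err t l)\<bar>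
      \<le> D * l2_norm_vec M (err t) *
        (l2_norm M (Compl (prodB (Proj (y i t)) (Proj (y j t)))) + D * l2_norm_vec M (err t))"
    by (rule cubic_bound) (rule that)
  show ?thesis
  \<comment> \<open>Of the first constant, \<open>4 * A\<close> comes from the four quadratic
    differences and \<open>4 * C\<^sup>2\<close> from absorbing their mixed term, which leaves
    coefficient 1 for the unresolved part. The 14 is 4 + 4 + 3 + 3 from the four memory
    estimates.\<close>
  proof (rule exI[of _ "4 * A + 4 * C\<^sup>2"], rule exI[of _ "14 * D\<^sup>2"], rule exI[of _ 1], intro allI impI)
    fix t :: real assume t: "0 \<le> t"
    define E where "E = l2_norm_vec M (err t)"
    define W where "W = l2_norm_vec M (unres t)"
    define q where "q = (\<lambda>i j. l2_norm M (Compl (prodB (Proj (y i t)) (Proj (y j t)))))"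
    define n where "n = (\<lambda>i j l. l2_inner M (prodB (z i t) (z j t)) (err t l) - l2_inner M (prodB (y i t) (y j t)) (err t l))"
    define \<kappa> where "\<kappa> = (\<lambda>m i j l. l2_inner M (cubic (Z t) m i j) (err t l))"
    have ko: "l2_inner M (ko_rhs (Z t) 1) (err t l) - l2_inner M (ko_rhs (Y t) 1) (err t l) = n 1 3 l"
      "l2_inner M (ko_rhs (Z t) 2) (err t l) - l2_inner M (ko_rhs (Y t) 2) (err t l) = - n 2 3 l"
      "l2_inner M (ko_rhs (Z t) 3) (err t l) - l2_inner M (ko_rhs (Y t) 3) (err t l) = n 2 2 l - n 1 1 l" for l
      using integrable_mult_span[OF projectable_products[OF t] err_in_span[OF t]]
        integrable_mult_span[OF projectable_pair[of "Z t", OF resolved_values[OF t]] err_in_span[OF t]]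
      by (simp_all add: ko_rhs_def n_def l2_inner_def left_diff_distrib)
    define N where "N = n 1 3 1 - n 2 3 2 + n 2 2 3 - n 1 1 3"
    define K where "K = (\<kappa> 3 1 3 1 - \<kappa> 1 1 1 1 + \<kappa> 1 2 2 1) + (\<kappa> 3 2 3 2 + \<kappa> 2 1 1 2 - \<kappa> 2 2 2 2)
      + (- 2 * \<kappa> 1 1 3 3 - 2 * \<kappa> 2 2 3 3)"
    \<comment> \<open>Half the derivative of the squared error: \<open>N\<close> collects the
      quadratic differences, \<open>K\<close> the memory terms.\<close>
    have sum: "(\<Sum>i\<in>UNIV. l2_inner M (t_rhs t (Z t) i) (err t i) - l2_inner M (ko_rhs (Y t) i) (err t i)) = N + t * K"
      unfolding sum_3 l2_inner_t_rhs[of "Z t", OF resolved_values[OF t] err_in_span[OF t]]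
        l2_inner_memory[of "Z t", OF resolved_values[OF t] err_in_span[OF t]]
      using ko[of 1] ko[of 2] ko[of 3] by (simp add: N_def K_def \<kappa>_def algebra_simps)
    have n_le: "\<bar>n i j l\<bar> \<le> E * (A * E + C * W)" for i j l
      using AC[OF t] by (simp add: n_def E_def W_def)
    have "N \<le> 4 * (E * (A * E + C * W))"
      using n_le[of 1 3 1] n_le[of 2 3 2] n_le[of 2 2 3] n_le[of 1 1 3] by (simp add: N_def)
    also have "\<dots> \<le> (4 * A + 4 * C\<^sup>2) * E\<^sup>2 + W\<^sup>2"
      using zero_le_power2[of "2 * C * E - W"] by (simp add: power2_eq_square algebra_simps)
    finally have N_le: "N \<le> (4 * A + 4 * C\<^sup>2) * E\<^sup>2 + W\<^sup>2" .
    have \<kappa>_le: "\<bar>\<kappa> m i j l\<bar> \<le> D * E * (q i j + D * E)" for m i j l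
      using D[OF t] by (simp add: \<kappa>_def E_def q_def)
    note up = abs_le_D1[OF \<kappa>_le] and lo = abs_le_D2[OF \<kappa>_le]
    \<comment> \<open>Young's inequality weighted so that \<open>3 D E q\<close> costs only one
      \<open>D\<^sup>2 E\<^sup>2\<close>; the resulting 9/4 in front of \<open>q\<^sup>2\<close> is
      below the permitted 5.\<close>
    have am_gm3: "3 * (D * E * (q i j + D * E)) \<le> 5 * (q i j)\<^sup>2 + 4 * D\<^sup>2 * E\<^sup>2" for i j
    proof -
      have "12 * (D * E * q i j) \<le> 9 * (q i j)\<^sup>2 + 4 * D\<^sup>2 * E\<^sup>2"
        using zero_le_power2[of "3 * q i j - 2 * D * E"] by (simp add: power2_eq_square algebra_simps)
      moreover have "3 * (D * E * (q i j + D * E)) = 3 * (D * E * q i j) + 3 * D\<^sup>2 * E\<^sup>2"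
        by (simp add: power2_eq_square algebra_simps)
      ultimately show ?thesis using zero_le_power2[of "q i j"] by linarith
    qed
    have am_gm2: "2 * (D * E * (q i j + D * E)) \<le> (q i j)\<^sup>2 + 3 * D\<^sup>2 * E\<^sup>2" for i j
      using zero_le_power2[of "q i j - D * E"] by (simp add: power2_eq_square algebra_simps)
    \<comment> \<open>The pairs \<open>1 3\<close> and \<open>2 3\<close> occur once in the first
      two components and with weight 2 in the third, hence 3; each diagonal pair occurs once in
      either of the first two components, hence 2.\<close>
    have "K \<le> 3 * (D * E * (q 1 3 + D * E)) + 3 * (D * E * (q 2 3 + D * E))
        + 2 * (D * E * (q 1 1 + D * E)) + 2 * (D * E * (q 2 2 + D * E))"
      using up[of 3 1 3 1] lo[of 1 1 1 1] up[of 1 2 2 1] up[of 3 2 3 2] up[of 2 1 1 2]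
        lo[of 2 2 2 2] lo[of 1 1 3 3] lo[of 2 2 3 3]
      unfolding K_def by linarith
    also have "\<dots> \<le> 14 * D\<^sup>2 * E\<^sup>2 + 5 * (q 1 3)\<^sup>2 + 5 * (q 2 3)\<^sup>2 + (q 1 1)\<^sup>2 + (q 2 2)\<^sup>2"
      using am_gm3[of 1 3] am_gm3[of 2 3] am_gm2[of 1 1] am_gm2[of 2 2] by linarith
    finally have "t * K \<le> t * (14 * D\<^sup>2 * E\<^sup>2 + 5 * (q 1 3)\<^sup>2 + 5 * (q 2 3)\<^sup>2 + (q 1 1)\<^sup>2 + (q 2 2)\<^sup>2)"
      using t by (rule mult_left_mono)
    with N_le have "N + t * K \<le> (4 * A + 4 * C\<^sup>2 + t * (14 * D\<^sup>2)) * E\<^sup>2 + 1 * W\<^sup>2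
        + 5 * t * (q 1 3)\<^sup>2 + 5 * t * (q 2 3)\<^sup>2 + t * (q 1 1)\<^sup>2 + t * (q 2 2)\<^sup>2"
      by (simp add: algebra_simps)
    then show "\<exists>D'. ((\<lambda>s. (l2_norm_vec M (err s))\<^sup>2) has_real_derivative D') (at t within {0..}) \<and>
      1 / 2 * D' \<le> (4 * A + 4 * C\<^sup>2 + t * (14 * D\<^sup>2)) * (l2_norm_vec M (err t))\<^sup>2 + 1 * (l2_norm_vec M (unres t))\<^sup>2
      + 5 * t * (l2_norm M (Compl (prodB (Proj (y 1 t)) (Proj (y 3 t)))))\<^sup>2
      + 5 * t * (l2_norm M (Compl (prodB (Proj (y 2 t)) (Proj (y 3 t)))))\<^sup>2
      + t * (l2_norm M (Compl (prodB (Proj (y 1 t)) (Proj (y 1 t)))))\<^sup>2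
      + t * (l2_norm M (Compl (prodB (Proj (y 2 t)) (Proj (y 2 t)))))\<^sup>2"
      using err_sq_deriv[OF t] unfolding sum E_def W_def q_def by (intro exI conjI) auto
  qed
qed

end

theorem theorem2:
  fixes M :: "'a measure" and \<xi> :: "'a \<Rightarrow> real ^ 'd::finite"
    and \<Phi> :: "('d \<Rightarrow> nat) \<Rightarrow> 'a \<Rightarrow> real" and pr :: nat
    and P :: "('a \<Rightarrow> real) \<Rightarrow> 'a \<Rightarrow> real"
    and y z :: "3 \<Rightarrow> real \<Rightarrow> 'a \<Rightarrow> real"
  assumes basis: "gpc_basis M \<xi> \<Phi>"
    and P: "P = orth_proj M (gpc_span \<Phi> (resolved pr))"
    and second_order: "\<And>i t. t \<ge> 0 \<Longrightarrow> square_integrable M (y i t)"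
    and initial_products:
      "\<And>i j k. k \<in> resolved pr \<Longrightarrow> integrable M (\<lambda>\<omega>. prodB (y i 0) (y j 0) \<omega> * \<Phi> k \<omega>)"
    and system: "kraichnan_orszag M y"
    and resolved_values: "\<And>i t. t \<ge> 0 \<Longrightarrow> z i t \<in> gpc_span \<Phi> (resolved pr)"
    and reduced: "t_model M P z"
  shows "\<exists>A B C :: real. \<forall>t\<ge>0. \<exists>D.
      ((\<lambda>s. (l2_norm_vec M (\<lambda>i \<omega>. z i s \<omega> - P (y i s) \<omega>))\<^sup>2) has_real_derivative D)
        (at t within {0..}) \<and>
      1 / 2 * D \<le>
        (A + t * B) * (l2_norm_vec M (\<lambda>i \<omega>. z i t \<omega> - P (y i t) \<omega>))\<^sup>2
        + C * (l2_norm_vec M (\<lambda>i. compl_proj P (y i t)))\<^sup>2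
        + 5 * t * (l2_norm M (compl_proj P (prodB (P (y 1 t)) (P (y 3 t)))))\<^sup>2
        + 5 * t * (l2_norm M (compl_proj P (prodB (P (y 2 t)) (P (y 3 t)))))\<^sup>2
        + t * (l2_norm M (compl_proj P (prodB (P (y 1 t)) (P (y 1 t)))))\<^sup>2
        + t * (l2_norm M (compl_proj P (prodB (P (y 2 t)) (P (y 2 t)))))\<^sup>2"
proof -
  interpret basis: gpc_basis M \<xi> \<Phi> by (rule basis)
  interpret t_model_error M \<xi> \<Phi> "resolved pr" y z
    using second_order initial_products system resolved_values reduced
    unfolding P by unfold_locales (auto simp: finite_resolved)
  show ?thesis unfolding P by (rule error_growth)
qed


end
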